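(* There is no volume preserving Mañé's example. That is, there does not exist a volume preserving partially hyperbolic diffeomorphism $f:\mathbb T^3\to\mathbb T^3$, homotopic to a linear Anosov automorphism $A$ of $\mathbb T^3$ with three distinct real eigenvalues, such that $f$ is not an Anosov diffeomorphism, $f$ is robustly transitive, and $f$ preserves the center foliation of $A$, i.e. $\mathcal F^c_f=\mathcal F^c_A$.
   Context: Partially hyperbolic: a diffeomorphism $f:M\to M$ of a compact manifold is partially hyperbolic if $TM$ admits a $Df$-invariant splitting $TM=E^s\oplus E^c\oplus E^u$ into nontrivial subbundles such that for any $x,y,z\in M$ and any unit vectors $v^s\in E^s_x$, $v^c\in E^c_y$, $v^u\in E^u_z$ one has $\|D_xf v^s\|<\|D_yf v^c\|<\|D_zf v^u\|$, where moreover $E^s$ is the stable direction and $E^u$ the unstable direction ($\|D_xf v^s\|<1<\|D_zf v^u\|$). An Anosov diffeomorphism is one for which the tangent bundle splits invariantly into only a stable and an unstable direction. A linear Anosov automorphism of $\mathbb T^3$ is given by a hyperbolic matrix $A\in SL(3,\mathbb Z)$ (no eigenvalue of modulus $1$). With real eigenvalues satisfying $|\mu_s|<|\mu_c|<|\mu_u|$, $A$ is regarded as partially hyperbolic, and $\mathcal F^c_A$ is the foliation by lines parallel to the eigenline of $\mu_c$. $\mathcal F^c_f$ denotes the $f$-invariant center foliation, tangent to $E^c$. Robustly transitive: every diffeomorphism in some $C^1$-neighborhood of $f$ is transitive (has a dense orbit). Mañé's example: a deformation of a linear Anosov automorphism of $\mathbb T^3$ with three distinct real eigenvalues which is not an Anosov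 diffeomorphism, is robustly transitive, and preserves the center foliation of the linear Anosov automorphism. *)

theory Defs
  imports "HOL-Analysis.Analysis"
begin

section \<open>The flat torus\<close>

definition lattice3 :: "(real^3) set" where
  "lattice3 = {k. \<forall>i. k $ i \<in> \<int>}"

lemma lattice3_0 [simp]: "0 \<in> lattice3"
  and lattice3_add: "a \<in> lattice3 \<Longrightarrow> b \<in> lattice3 \<Longrightarrow> a + b \<in> lattice3"
  and lattice3_diff: "a \<in> lattice3 \<Longrightarrow> b \<in> lattice3 \<Longrightarrow> a - b \<in> lattice3"
  and lattice3_minus: "a \<in> lattice3 \<Longrightarrow> - a \<in> lattice3"
  by (simp_all add: lattice3_def)

lemma lattice3_norm_less_1:
  assumes "k \<in> lattice3" "norm k < 1" shows "k = 0"
proof -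
  have "k $ i = 0" for i
  proof -
    have "\<bar>k $ i\<bar> < 1"
      using component_le_norm_cart[of k i] assms(2) by linarith
    moreover have "k $ i \<in> \<int>"
      using assms(1) by (simp add: lattice3_def)
    ultimately show ?thesis
      by (metis Ints_nonzero_abs_less1)
  qed
  then show ?thesis by (simp add: vec_eq_iff)
qed

quotient_type torus3 = "real^3" / "\<lambda>x y. x - y \<in> lattice3"
  morphisms torus_rep torus_proj
proof (rule equivpI)
  show "reflp (\<lambda>x y. x - y \<in> lattice3)" by (simp add: reflp_def)
  show "symp (\<lambda>x y. x - y \<in> lattice3)"
    unfolding symp_def by (metis lattice3_minus minus_diff_eq)
  show "transp (\<lambda>x y. x - y \<in> lattice3)"
    unfolding transp_def by (metis lattice3_add diff_add_cancel add_diff_eq)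
qed

lemma torus_proj_eq_iff: "torus_proj x = torus_proj y \<longleftrightarrow> x - y \<in> lattice3"
  by (rule torus3.abs_eq_iff)

lemma torus_proj_surj: "\<exists>x. torus_proj x = q"
  by (induction q rule: torus3.abs_induct) blast

lemma torus_proj_add_lattice: "k \<in> lattice3 \<Longrightarrow> torus_proj (x + k) = torus_proj x"
  by (simp add: torus_proj_eq_iff)

instantiation torus3 :: metric_space
begin

definition dist_torus3 :: "torus3 \<Rightarrow> torus3 \<Rightarrow> real" where
  "dist_torus3 q r = Inf {dist x y | x y. torus_proj x = q \<and> torus_proj y = r}"

definition uniformity_torus3 :: "(torus3 \<times> torus3) filter" where
  "uniformity_torus3 = (INF e\<in>{0<..}. principal {(q, r). dist q r < e})"

definition open_torus3 :: "torus3 set \<Rightarrow> bool" where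
  "open_torus3 U \<longleftrightarrow> (\<forall>q\<in>U. eventually (\<lambda>(q', r). q' = q \<longrightarrow> r \<in> U) uniformity)"

lemma dist_torus3_less_iff:
  "dist (torus_proj x) r < e \<longleftrightarrow> (\<exists>y. torus_proj y = r \<and> dist x y < e)"
proof -
  let ?S = "{dist x' y | x' y. torus_proj x' = torus_proj x \<and> torus_proj y = r}"
  have ne: "?S \<noteq> {}" using torus_proj_surj[of r] by auto
  have bb: "bdd_below ?S" by (rule bdd_belowI[of _ 0]) auto
  have "dist (torus_proj x) r < e \<longleftrightarrow> (\<exists>d\<in>?S. d < e)"
    unfolding dist_torus3_def by (rule cInf_less_iff[OF ne bb])
  also have "\<dots> \<longleftrightarrow> (\<exists>y. torus_proj y = r \<and> dist x y < e)"
  proof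
    assume "\<exists>d\<in>?S. d < e"
    then obtain x' y where *: "torus_proj x' = torus_proj x" "torus_proj y = r" "dist x' y < e"
      by auto
    then have k: "x - x' \<in> lattice3" by (metis torus_proj_eq_iff)
    have "torus_proj (y + (x - x')) = r"
      using k * torus_proj_add_lattice by simp
    moreover have "dist x (y + (x - x')) = dist x' y"
      by (simp add: dist_norm)
    ultimately show "\<exists>y. torus_proj y = r \<and> dist x y < e"
      using *(3) by metis
  qed auto
  finally show ?thesis .
qed

instance
proof
  show "uniformity = (INF e\<in>{0<..}. principal {(q, r :: torus3). dist q r < e})"
    by (rule uniformity_torus3_def)
  show "open U \<longleftrightarrow> (\<forall>q\<in>U. eventually (\<lambda>(q', r). q' = q \<longrightarrow> r \<in> U) uniformity)"
    for U :: "torus3 set"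
    by (rule open_torus3_def)
  have nonneg: "dist q r \<ge> 0" for q r :: torus3
    unfolding dist_torus3_def using torus_proj_surj[of q] torus_proj_surj[of r]
    by (intro cInf_greatest) auto
  have sym: "dist q r = dist r q" for q r :: torus3
    unfolding dist_torus3_def by (metis dist_commute)
  show "dist q r = 0 \<longleftrightarrow> q = r" for q r :: torus3
  proof
    assume 0: "dist q r = 0"
    obtain x where x: "torus_proj x = q" using torus_proj_surj by blast
    obtain y where y: "torus_proj y = r" "dist x y < 1/2"
      using dist_torus3_less_iff[of x r "1/2"] x 0 by auto
    have "x = y"
    proof (rule ccontr)
      assume "x \<noteq> y"
      then obtain z where z: "torus_proj z = r" "dist x z < dist x y"
        using dist_torus3_less_iff[of x r "dist x y"] x 0 by auto
      have "z - y \<in> lattice3" using z y by (metis torus_proj_eq_iff)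
      moreover have "norm (z - y) < 1"
        using dist_triangle[of z y x] z y by (simp add: dist_norm norm_minus_commute)
      ultimately have "z - y = 0" by (rule lattice3_norm_less_1)
      then show False using z by simp
    qed
    then show "q = r" using x y by simp
  next
    assume "q = r"
    moreover obtain x where "torus_proj x = r" using torus_proj_surj by blast
    ultimately have "dist q r < e" if "e > 0" for e
      using that dist_torus3_less_iff[of x r e] by (metis dist_self)
    then show "dist q r = 0" using nonneg[of q r] by (metis less_irrefl order_le_less)
  qed
  show "dist q r \<le> dist q s + dist r s" for q r s :: torus3
  proof (rule field_le_epsilon)
    fix e :: real assume e: "e > 0"
    obtain x where x: "torus_proj x = q" using torus_proj_surj by blast
    obtain z where z: "torus_proj z = s" "dist x z < dist q s + e/2"
      using dist_torus3_less_iff[of x s "dist q s + e/2"] x e by auto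
    obtain y where y: "torus_proj y = r" "dist z y < dist s r + e/2"
      using dist_torus3_less_iff[of z r "dist s r + e/2"] z e by auto
    have "dist x y < dist q s + dist r s + e"
      using dist_triangle[of x y z] z y sym[of r s] by linarith
    then show "dist q r \<le> dist q s + dist r s + e"
      using dist_torus3_less_iff[of x r] x y by (metis less_imp_le)
  qed
qed

end

text \<open>The metric induces the quotient topology.\<close>

lemma open_torus3_iff: "open U \<longleftrightarrow> open (torus_proj -` U)"
proof
  assume U: "open U"
  show "open (torus_proj -` U)"
    unfolding open_dist
  proof safe
    fix x assume "torus_proj x \<in> U"
    then obtain e where e: "e > 0" "\<And>r. dist r (torus_proj x) < e \<Longrightarrow> r \<in> U"
      using U unfolding open_dist by metis
    then have "torus_proj y \<in> U" if "dist y x < e" for y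
      using that dist_torus3_less_iff[of x "torus_proj y" e] by (metis dist_commute)
    then show "\<exists>e>0. \<forall>y. dist y x < e \<longrightarrow> y \<in> torus_proj -` U"
      using e(1) by auto
  qed
next
  assume U: "open (torus_proj -` U)"
  show "open U"
    unfolding open_dist
  proof
    fix q assume "q \<in> U"
    moreover obtain x where x: "torus_proj x = q" using torus_proj_surj by blast
    ultimately have "x \<in> torus_proj -` U" by simp
    then obtain e where e: "e > 0" "\<And>y. dist y x < e \<Longrightarrow> torus_proj y \<in> U"
      using U unfolding open_dist by (metis vimage_eq)
    have "r \<in> U" if "dist r q < e" for r
      using that x dist_torus3_less_iff[of x r e] e(2) by (metis dist_commute)
    then show "\<exists>e>0. \<forall>r. dist r q < e \<longrightarrow> r \<in> U" using e(1) by blast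
  qed
qed

definition torus_volume :: "torus3 measure" where
  "torus_volume =
     distr (restrict_space lborel {x :: real^3. \<forall>i. 0 \<le> x $ i \<and> x $ i < 1}) borel torus_proj"

definition volume_preserving :: "(torus3 \<Rightarrow> torus3) \<Rightarrow> bool" where
  "volume_preserving f \<longleftrightarrow>
     f \<in> measurable torus_volume torus_volume \<and> distr torus_volume torus_volume f = torus_volume"


section \<open>Differentiation on the torus\<close>

text \<open>
  Local inverses of \<^const>\<open>torus_proj\<close> are the charts of the torus, and they trivialise its
  tangent bundle. So tangent spaces are identified with \<^typ>\<open>real^3\<close>, and the derivative of a
  torus map at a point is the derivative of a local lift.
\<close>

definition has_torus_derivative ::
    "(torus3 \<Rightarrow> torus3) \<Rightarrow> ((real^3) \<Rightarrow>\<^sub>L (real^3)) \<Rightarrow> torus3 \<Rightarrow> bool" where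
  "has_torus_derivative f D q \<longleftrightarrow>
     (\<exists>x F. torus_proj x = q \<and> (\<forall>\<^sub>F y in nhds x. torus_proj (F y) = f (torus_proj y)) \<and>
            (F has_derivative blinfun_apply D) (at x))"

definition has_torus_velocity :: "(real \<Rightarrow> torus3) \<Rightarrow> real^3 \<Rightarrow> real \<Rightarrow> bool" where
  "has_torus_velocity \<gamma> v t \<longleftrightarrow>
     (\<exists>\<Gamma>. (\<forall>\<^sub>F s in nhds t. torus_proj (\<Gamma> s) = \<gamma> s) \<and> (\<Gamma> has_vector_derivative v) (at t))"

lemma has_torus_derivative_unique:
  assumes "has_torus_derivative f D q" "has_torus_derivative f D' q"
  shows "D = D'"
proof -
  obtain x F where x: "torus_proj x = q"
    and F: "\<forall>\<^sub>F y in nhds x. torus_proj (F y) = f (torus_proj y)"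
    and dF: "(F has_derivative blinfun_apply D) (at x)"
    using assms(1) unfolding has_torus_derivative_def by blast
  obtain x' F' where x': "torus_proj x' = q"
    and F': "\<forall>\<^sub>F y in nhds x'. torus_proj (F' y) = f (torus_proj y)"
    and dF': "(F' has_derivative blinfun_apply D') (at x')"
    using assms(2) unfolding has_torus_derivative_def by blast
  define k where "k = x' - x"
  have k: "k \<in> lattice3" using x x' by (metis torus_proj_eq_iff k_def)
  define G where "G = (\<lambda>y. F' (y + k))"
  have dG: "(G has_derivative blinfun_apply D') (at x)"
  proof -
    have 1: "((\<lambda>y. y + k) has_derivative (\<lambda>h. h)) (at x)"
      by (auto intro!: derivative_eq_intros)
    have "(F' has_derivative blinfun_apply D') (at ((\<lambda>y. y + k) x))"
      using dF' by (simp add: k_def)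
    from has_derivative_compose[OF 1 this] show ?thesis by (simp add: G_def)
  qed
  have "filterlim (\<lambda>y. y + k) (nhds (x + k)) (nhds x)"
    by (intro tendsto_intros filterlim_ident)
  then have "\<forall>\<^sub>F y in nhds x. torus_proj (F' (y + k)) = f (torus_proj (y + k))"
    using F' unfolding k_def by (auto dest: eventually_compose_filterlim)
  then have G: "\<forall>\<^sub>F y in nhds x. torus_proj (G y) = f (torus_proj y)"
    by (simp add: G_def torus_proj_add_lattice[OF k])
  define m where "m = G x - F x"
  have "isCont (\<lambda>y. G y - F y) x"
    using dF dG has_derivative_continuous by (intro continuous_diff) blast+
  then have "filterlim (\<lambda>y. G y - F y) (nhds m) (nhds x)"
    unfolding m_def by (simp add: continuous_at tendsto_nhds_iff)
  then have near: "\<forall>\<^sub>F y in nhds x. dist (G y - F y) m < 1"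
    by (rule tendstoD) simp
  have m: "m \<in> lattice3"
    using eventually_nhds_x_imp_x[OF F] eventually_nhds_x_imp_x[OF G]
    unfolding m_def by (metis torus_proj_eq_iff)
  have "\<forall>\<^sub>F y in nhds x. G y - m = F y"
    using F G near
  proof eventually_elim
    case (elim y)
    have "G y - F y \<in> lattice3" using elim by (metis torus_proj_eq_iff)
    then have "(G y - F y) - m \<in> lattice3" using m by (rule lattice3_diff)
    moreover have "norm ((G y - F y) - m) < 1"
      using elim(3) by (simp add: dist_norm)
    ultimately have "(G y - F y) - m = 0"
      by (rule lattice3_norm_less_1)
    then show ?case by (simp add: algebra_simps)
  qed
  moreover have "((\<lambda>y. G y - m) has_derivative blinfun_apply D') (at x)"
    using dG by (auto intro!: derivative_eq_intros)
  ultimately have "(F has_derivative blinfun_apply D') (at x)"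
    by (smt (verit) eventually_at_filter eventually_mono eventually_nhds_x_imp_x
        has_derivative_transform_eventually UNIV_I)
  then have "blinfun_apply D = blinfun_apply D'"
    using dF has_derivative_unique by blast
  then show ?thesis by (simp add: blinfun_apply_inject)
qed

definition torus_deriv :: "(torus3 \<Rightarrow> torus3) \<Rightarrow> torus3 \<Rightarrow> (real^3) \<Rightarrow>\<^sub>L (real^3)" where
  "torus_deriv f q = (THE D. has_torus_derivative f D q)"

definition C1_torus_map :: "(torus3 \<Rightarrow> torus3) \<Rightarrow> bool" where
  "C1_torus_map f \<longleftrightarrow>
     (\<forall>q. \<exists>D. has_torus_derivative f D q) \<and> continuous_on UNIV (torus_deriv f)"

definition diffeomorphism :: "(torus3 \<Rightarrow> torus3) \<Rightarrow> bool" where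
  "diffeomorphism f \<longleftrightarrow> bij f \<and> C1_torus_map f \<and> C1_torus_map (inv f)"


section \<open>Invariant splittings\<close>

text \<open>
  The norm in the definitions of partial hyperbolicity and of Anosov diffeomorphisms comes from
  some Riemannian metric, not necessarily the flat one; it need only be continuous. All inequalities
  below are strict and range over compact sets, so smooth metrics would give the same notions.
\<close>

definition riemannian_metric :: "(torus3 \<Rightarrow> real^3 \<Rightarrow> real^3 \<Rightarrow> real) \<Rightarrow> bool" where
  "riemannian_metric g \<longleftrightarrow>
     (\<forall>q. bilinear (g q) \<and> (\<forall>v w. g q v w = g q w v) \<and> (\<forall>v. v \<noteq> 0 \<longrightarrow> g q v v > 0)) \<and>
     (\<forall>v w. continuous_on UNIV (\<lambda>q. g q v w))"

definition metric_norm :: "(torus3 \<Rightarrow> real^3 \<Rightarrow> real^3 \<Rightarrow> real) \<Rightarrow> torus3 \<Rightarrow> real^3 \<Rightarrow> real" where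
  "metric_norm g q v = sqrt (g q v v)"

text \<open>
  Subbundles are continuous, of constant rank \<open>k\<close>; \<open>span\<close> and \<open>dim\<close> together say that the
  local frame is linearly independent.
\<close>

definition subbundle :: "nat \<Rightarrow> (torus3 \<Rightarrow> (real^3) set) \<Rightarrow> bool" where
  "subbundle k E \<longleftrightarrow>
     (\<forall>q. \<exists>U e. open U \<and> q \<in> U \<and> (\<forall>i<k. continuous_on U (e i)) \<and>
        (\<forall>r\<in>U. E r = span ((\<lambda>i. e i r) ` {..<k}) \<and> dim (E r) = k))"

definition nontrivial_subbundle :: "(torus3 \<Rightarrow> (real^3) set) \<Rightarrow> bool" where
  "nontrivial_subbundle E \<longleftrightarrow> (\<exists>k>0. subbundle k E)"

definition invariant_bundle :: "(torus3 \<Rightarrow> torus3) \<Rightarrow> (torus3 \<Rightarrow> (real^3) set) \<Rightarrow> bool" where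
  "invariant_bundle f E \<longleftrightarrow> (\<forall>q. blinfun_apply (torus_deriv f q) ` E q = E (f q))"

definition partially_hyperbolic_splitting ::
    "(torus3 \<Rightarrow> torus3) \<Rightarrow> (torus3 \<Rightarrow> (real^3) set) \<Rightarrow> (torus3 \<Rightarrow> (real^3) set) \<Rightarrow>
     (torus3 \<Rightarrow> (real^3) set) \<Rightarrow> bool" where
  "partially_hyperbolic_splitting f Es Ec Eu \<longleftrightarrow>
     nontrivial_subbundle Es \<and> nontrivial_subbundle Ec \<and> nontrivial_subbundle Eu \<and>
     (\<forall>q v. \<exists>!(a, b, c). a \<in> Es q \<and> b \<in> Ec q \<and> c \<in> Eu q \<and> v = a + b + c) \<and>
     invariant_bundle f Es \<and> invariant_bundle f Ec \<and> invariant_bundle f Eu \<and>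
     (\<exists>g. riemannian_metric g \<and>
        (\<forall>x y z. \<forall>vs\<in>Es x. \<forall>vc\<in>Ec y. \<forall>vu\<in>Eu z.
           metric_norm g x vs = 1 \<longrightarrow> metric_norm g y vc = 1 \<longrightarrow> metric_norm g z vu = 1 \<longrightarrow>
             metric_norm g (f x) (torus_deriv f x vs) < metric_norm g (f y) (torus_deriv f y vc) \<and>
             metric_norm g (f y) (torus_deriv f y vc) < metric_norm g (f z) (torus_deriv f z vu) \<and>
             metric_norm g (f x) (torus_deriv f x vs) < 1 \<and>
             1 < metric_norm g (f z) (torus_deriv f z vu)))"

definition partially_hyperbolic :: "(torus3 \<Rightarrow> torus3) \<Rightarrow> bool" where
  "partially_hyperbolic f \<longleftrightarrow>
     diffeomorphism f \<and> (\<exists>Es Ec Eu. partially_hyperbolic_splitting f Es Ec Eu)"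

definition anosov :: "(torus3 \<Rightarrow> torus3) \<Rightarrow> bool" where
  "anosov f \<longleftrightarrow> diffeomorphism f \<and>
     (\<exists>Es Eu. nontrivial_subbundle Es \<and> nontrivial_subbundle Eu \<and>
        (\<forall>q v. \<exists>!(a, b). a \<in> Es q \<and> b \<in> Eu q \<and> v = a + b) \<and>
        invariant_bundle f Es \<and> invariant_bundle f Eu \<and>
        (\<exists>g. riemannian_metric g \<and>
           (\<forall>x. \<forall>vs\<in>Es x. metric_norm g x vs = 1 \<longrightarrow>
              metric_norm g (f x) (torus_deriv f x vs) < 1) \<and>
           (\<forall>z. \<forall>vu\<in>Eu z. metric_norm g z vu = 1 \<longrightarrow>
              1 < metric_norm g (f z) (torus_deriv f z vu))))"


section \<open>Center foliations\<close>

text \<open>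
  A foliation of the torus by curves tangent to \<open>E\<close>, given by its set of leaves. Around every
  point there is a chart \<open>\<psi>\<close> on a product of a disc and an interval such that the connected
  components of the intersections of leaves with the chart domain are the plaques
  \<open>t \<mapsto> \<psi> (c, t)\<close>. The charts are only continuous in \<open>c\<close>, but the plaques are \<open>C\<^sup>1\<close> curves,
  with velocity \<open>V\<close> depending continuously on the point.
\<close>

definition foliation_tangent_to ::
    "torus3 set set \<Rightarrow> (torus3 \<Rightarrow> (real^3) set) \<Rightarrow> bool" where
  "foliation_tangent_to \<F> E \<longleftrightarrow>
     \<Union>\<F> = UNIV \<and> disjoint \<F> \<and> {} \<notin> \<F> \<and> (\<forall>L\<in>\<F>. connected L) \<and>
     (\<forall>q. \<exists>U (\<psi> :: (real^2) \<times> real \<Rightarrow> torus3) \<phi> V.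
        open U \<and> q \<in> U \<and> homeomorphism (ball 0 1 \<times> {-1<..<1}) U \<psi> \<phi> \<and>
        (\<forall>L\<in>\<F>. \<forall>C\<in>components (L \<inter> U). \<exists>c\<in>ball 0 1. C = (\<lambda>t. \<psi> (c, t)) ` {-1<..<1}) \<and>
        continuous_on (ball 0 1 \<times> {-1<..<1}) V \<and>
        (\<forall>c\<in>ball 0 1. \<forall>t\<in>{-1<..<1}. V (c, t) \<noteq> 0 \<and> V (c, t) \<in> E (\<psi> (c, t)) \<and>
           has_torus_velocity (\<lambda>s. \<psi> (c, s)) (V (c, t)) t))"

definition center_foliation :: "(torus3 \<Rightarrow> torus3) \<Rightarrow> torus3 set set \<Rightarrow> bool" where
  "center_foliation f \<F> \<longleftrightarrow>
     (\<exists>Es Ec Eu. partially_hyperbolic_splitting f Es Ec Eu \<and> foliation_tangent_to \<F> Ec) \<and>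
     (\<forall>L\<in>\<F>. f ` L \<in> \<F>)"


section \<open>Linear automorphisms\<close>

definition eigenvalue :: "'a::field^'n^'n \<Rightarrow> 'a \<Rightarrow> bool" where
  "eigenvalue A \<mu> \<longleftrightarrow> (\<exists>v. v \<noteq> 0 \<and> A *v v = \<mu> *s v)"

definition hyperbolic_matrix :: "int^3^3 \<Rightarrow> bool" where
  "hyperbolic_matrix A \<longleftrightarrow>
     (\<forall>\<mu>::complex. eigenvalue (map_matrix of_int A) \<mu> \<longrightarrow> cmod \<mu> \<noteq> 1)"

lift_definition torus_linear :: "int^3^3 \<Rightarrow> torus3 \<Rightarrow> torus3"
  is "\<lambda>A x. map_matrix real_of_int A *v x"
proof -
  fix A :: "int^3^3" and x y :: "real^3"
  assume "x - y \<in> lattice3"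
  then have "map_matrix real_of_int A *v (x - y) \<in> lattice3"
    by (auto simp: lattice3_def matrix_vector_mult_def intro!: Ints_sum Ints_mult)
  then show "map_matrix real_of_int A *v x - map_matrix real_of_int A *v y \<in> lattice3"
    by (simp add: matrix_vector_mult_diff_distrib)
qed

definition linear_anosov :: "int^3^3 \<Rightarrow> bool" where
  "linear_anosov A \<longleftrightarrow> det A = 1 \<and> hyperbolic_matrix A"

definition linear_foliation :: "int^3^3 \<Rightarrow> real \<Rightarrow> torus3 set set" where
  "linear_foliation A \<mu> =
     range (\<lambda>x. torus_proj ` {x + v | v. map_matrix real_of_int A *v v = \<mu> *s v})"


section \<open>Transitivity\<close>

definition transitive :: "(torus3 \<Rightarrow> torus3) \<Rightarrow> bool" where
  "transitive f \<longleftrightarrow> (\<exists>q. closure (range (\<lambda>n. (f ^^ n) q)) = UNIV)"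

definition robustly_transitive :: "(torus3 \<Rightarrow> torus3) \<Rightarrow> bool" where
  "robustly_transitive f \<longleftrightarrow>
     (\<exists>\<epsilon>>0. \<forall>g. diffeomorphism g \<and>
        (\<forall>q. dist (f q) (g q) < \<epsilon> \<and> norm (torus_deriv f q - torus_deriv g q) < \<epsilon>) \<longrightarrow>
        transitive g)"

end

theory Submission
  imports Defs
begin

text \<open>
  Why no such \<open>f\<close> exists: a volume preserving \<open>f\<close> whose center leaves are the lines parallel to
  the center eigenvector \<open>v\<close> of \<open>A\<close> scales every center leaf by the constant factor
  \<open>\<mu>\<^sub>c\<close>, like \<open>A\<close>, and \<open>\<bar>\<mu>\<^sub>c\<bar> \<noteq> 1\<close>; so the center direction can be joined to the stable or to the
  unstable direction, and \<open>f\<close> is Anosov.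

  In more detail, let \<open>F\<close> be a lift of \<open>f\<close> to \<open>\<real>\<^sup>3\<close>. It maps lines parallel to \<open>v\<close> to such lines, so
  \<open>DF(x) v = \<lambda>(x) v\<close>, and \<open>F\<close> induces a map of the plane \<open>\<real>\<^sup>3 / \<real>v\<close>. The derivative of the
  induced map depends only on the line through \<open>x\<close>, and its determinant is
  \<open>det DF(x) / \<lambda>(x)\<close>. Since \<open>\<bar>det DF\<bar> = 1\<close> everywhere, \<open>\<bar>\<lambda>\<bar>\<close> is constant on each line, and so is
  \<open>\<lambda>\<close> by continuity (\<open>center_multiplier_const_on_line\<close>). Hence \<open>F\<close> is affine with slope
  \<open>\<lambda>(x)\<close> on the line through \<open>x\<close>. As \<open>f\<close> is homotopic to \<open>A\<close>, the lift can be chosen at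
  bounded distance from the linear map \<open>A\<close>, and two affine maps of a line at bounded distance
  have the same slope: \<open>\<lambda>(x) = \<mu>\<^sub>c\<close> (\<open>center_multiplier_eq_linear\<close>).

  Three facts feed this argument. The bounded lift is built by following the homotopy in
  finitely many small steps (\<open>homotopy_lift_bounded\<close>). The Jacobian is \<open>1\<close> in absolute value by
  the change of variables formula on small balls, on which the projection to the torus is injective
  (\<open>emeasure_torus_volume_proj_image\<close>, \<open>abs_det_eq_1_if_measure_preserving\<close>). The center bundle
  is spanned by \<open>v\<close> because the plaques of the foliation are differentiable curves inside lines
  (\<open>foliation_by_lines_tangent\<close>). For the last step, the contraction on the sum of two bundles must
  be seen in a single metric, which is made by declaring the three bundles orthogonal
  (\<open>anosov_if_center_homothety\<close>).
\<close>

section \<open>The projection to the torus and lifts\<close>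

lemma dist_torus_proj_le: "dist (torus_proj x) (torus_proj y) \<le> dist x y"
proof (rule ccontr)
  assume "\<not> ?thesis"
  then have "dist x y < dist (torus_proj x) (torus_proj y)" by simp
  then have "dist (torus_proj x) (torus_proj y) < dist (torus_proj x) (torus_proj y)"
    unfolding dist_torus3_less_iff by blast
  then show False by simp
qed

lemma dist_torus_proj_eq:
  assumes "dist x y < 1/2"
  shows "dist (torus_proj x) (torus_proj y) = dist x y"
proof (rule antisym[OF dist_torus_proj_le], rule ccontr)
  assume "\<not> dist x y \<le> dist (torus_proj x) (torus_proj y)"
  then obtain z where z: "torus_proj z = torus_proj y" "dist x z < dist x y"
    using dist_torus3_less_iff[of x "torus_proj y" "dist x y"] by auto
  have "z - y \<in> lattice3" using z(1) by (simp add: torus_proj_eq_iff)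
  moreover have "norm (z - y) < 1"
    using dist_triangle[of z y x] z assms by (simp add: dist_norm norm_minus_commute)
  ultimately have "z - y = 0" by (rule lattice3_norm_less_1)
  then show False using z by simp
qed

lemma continuous_on_torus_proj [continuous_intros]:
  "continuous_on S g \<Longrightarrow> continuous_on S (\<lambda>x. torus_proj (g x))"
  by (rule continuous_on_compose2[of UNIV torus_proj])
    (auto simp: continuous_on_iff intro: le_less_trans[OF dist_torus_proj_le])

lemma inj_on_torus_proj_ball:
  assumes "r \<le> 1/4"
  shows "inj_on torus_proj (cball x r)"
proof (rule inj_onI)
  fix y z assume *: "y \<in> cball x r" "z \<in> cball x r" "torus_proj y = torus_proj z"
  have "norm (y - z) \<le> 2 * r"
    using dist_triangle[of y z x] *(1,2) by (simp add: dist_norm norm_minus_commute)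
  moreover have "y - z \<in> lattice3" using *(3) by (simp add: torus_proj_eq_iff)
  ultimately show "y = z" using lattice3_norm_less_1[of "y - z"] assms by simp
qed

lemma countable_lattice3: "countable lattice3"
proof -
  have "lattice3 \<subseteq> range (\<lambda>(a::int, b::int, c::int). vector [real_of_int a, real_of_int b, real_of_int c])"
  proof
    fix k :: "real^3" assume "k \<in> lattice3"
    then obtain a b c where "k $ 1 = of_int a" "k $ 2 = of_int b" "k $ 3 = of_int c"
      unfolding lattice3_def Ints_def by blast
    then have "k = (\<lambda>(a::int, b::int, c::int). vector [real_of_int a, real_of_int b, real_of_int c]) (a, b, c)"
      by (simp add: vec_eq_iff forall_3)
    then show "k \<in> range (\<lambda>(a::int, b::int, c::int). vector [real_of_int a, real_of_int b, real_of_int c])"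
      by blast
  qed
  then show ?thesis by (rule countable_subset) simp
qed

definition unit_cube :: "(real^3) set" where
  "unit_cube = {x. \<forall>i. 0 \<le> x $ i \<and> x $ i < 1}"

lemma unit_cube_translates:
  "\<exists>!k. k \<in> lattice3 \<and> x + k \<in> unit_cube"
proof (rule ex1I)
  show "(\<chi> i. - of_int \<lfloor>x $ i\<rfloor>) \<in> lattice3 \<and> x + (\<chi> i. - of_int \<lfloor>x $ i\<rfloor>) \<in> unit_cube"
    by (simp add: lattice3_def unit_cube_def) linarith
  fix k assume k: "k \<in> lattice3 \<and> x + k \<in> unit_cube"
  show "k = (\<chi> i. - of_int \<lfloor>x $ i\<rfloor>)"
  proof (subst vec_eq_iff, rule allI)
    fix i
    obtain n where n: "k $ i = of_int n" using k by (auto simp: lattice3_def elim: Ints_cases)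
    have "0 \<le> x $ i + of_int n" "x $ i + of_int n < 1"
      using k by (auto simp: unit_cube_def simp flip: n)
    then have "\<lfloor>x $ i\<rfloor> = - n" by linarith
    then show "k $ i = (\<chi> i. - of_int \<lfloor>x $ i\<rfloor>) $ i" by (simp add: n)
  qed
qed

lemma compact_torus3: "compact (UNIV :: torus3 set)"
proof -
  have "q \<in> torus_proj ` cbox 0 1" for q
  proof -
    obtain x where x: "torus_proj x = q" using torus_proj_surj by blast
    obtain k where k: "k \<in> lattice3" "x + k \<in> unit_cube" using unit_cube_translates by blast
    have "x + k \<in> cbox 0 1" using k(2) by (auto simp: unit_cube_def mem_box_cart less_imp_le)
    then show ?thesis using torus_proj_add_lattice[OF k(1), of x] x by (metis imageI)
  qed
  then have "UNIV = torus_proj ` cbox 0 1" by blast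
  moreover have "compact (torus_proj ` cbox 0 1)"
    by (intro compact_continuous_image continuous_intros) simp
  ultimately show ?thesis by simp
qed

text \<open>
  The projection is a local isometry, so a lift is as continuous as the map it lifts, once it is
  known not to jump to a different sheet.
\<close>

lemma isCont_lift:
  fixes G :: "'a::t2_space \<Rightarrow> real^3"
  assumes near: "\<forall>\<^sub>F y in at x. dist (G y) (G x) < 1/2"
    and cont: "isCont (\<lambda>y. torus_proj (G y)) x"
  shows "isCont G x"
  unfolding isCont_def
proof (rule tendstoI)
  fix e :: real assume "e > 0"
  then have "\<forall>\<^sub>F y in at x. dist (torus_proj (G y)) (torus_proj (G x)) < e"
    using cont unfolding isCont_def by (rule tendstoD[rotated])
  then show "\<forall>\<^sub>F y in at x. dist (G y) (G x) < e"
    using near by eventually_elim (metis dist_torus_proj_eq)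
qed

text \<open>
  If two torus maps are uniformly close, a lift of the first determines a lift of the second: over
  each point, take the only candidate close to the given lift.
\<close>

lemma lift_nearby_map:
  assumes g2: "continuous_on UNIV g2"
    and G1: "continuous_on UNIV G1" "\<And>x. torus_proj (G1 x) = g1 (torus_proj x)"
    and near: "\<And>q. dist (g1 q) (g2 q) < 1/8"
  obtains G2 where "continuous_on UNIV G2" "\<And>x. torus_proj (G2 x) = g2 (torus_proj x)"
    "\<And>x. dist (G1 x) (G2 x) < 1/8"
proof -
  have "\<exists>z. torus_proj z = g2 (torus_proj x) \<and> dist (G1 x) z < 1/8" for x
    using near[of "torus_proj x"] unfolding G1(2)[symmetric] dist_torus3_less_iff .
  then obtain G2 where G2: "\<And>x. torus_proj (G2 x) = g2 (torus_proj x)" "\<And>x. dist (G1 x) (G2 x) < 1/8"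
    by metis
  \<comment> \<open>With displacements below \<open>1/8\<close>, values of \<open>G2\<close> at nearby points differ by less than \<open>3/8\<close>.\<close>
  have "isCont G2 x" for x
  proof (rule isCont_lift)
    have "(G1 \<longlongrightarrow> G1 x) (at x)" using G1(1) by (simp add: continuous_on_def)
    then have "\<forall>\<^sub>F y in at x. dist (G1 y) (G1 x) < 1/8" by (rule tendstoD) simp
    then show "\<forall>\<^sub>F y in at x. dist (G2 y) (G2 x) < 1/2"
    proof eventually_elim
      case (elim y)
      have "dist (G2 y) (G2 x) \<le> dist (G1 y) (G2 y) + dist (G1 y) (G1 x) + dist (G1 x) (G2 x)"
        by (smt (verit) dist_commute dist_triangle)
      then show ?case using elim G2(2)[of x] G2(2)[of y] by linarith
    qed
    have "continuous_on UNIV (\<lambda>y. g2 (torus_proj y))"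
      by (rule continuous_on_compose2[OF g2]) (auto intro: continuous_intros)
    then show "isCont (\<lambda>y. torus_proj (G2 y)) x"
      by (simp add: G2(1) continuous_on_eq_continuous_at)
  qed
  then have "continuous_on UNIV G2" by (simp add: continuous_at_imp_continuous_on)
  then show thesis using that G2 by blast
qed

text \<open>
  By compactness, a homotopy is a finite chain of maps, each close to the next. Lifting along the
  chain moves a point by a bounded amount in each step, which gives the uniform bound.
\<close>

lemma homotopy_lift_bounded:
  assumes hom: "homotopic_with_canon (\<lambda>_. True) UNIV UNIV g0 g1"
    and G0: "continuous_on UNIV G0" "\<And>x. torus_proj (G0 x) = g0 (torus_proj x)"
  obtains G1 C where "continuous_on UNIV G1" "\<And>x. torus_proj (G1 x) = g1 (torus_proj x)"
    "\<And>x. dist (G0 x) (G1 x) \<le> C"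
proof -
  obtain h :: "real \<times> torus3 \<Rightarrow> torus3"
    where *: "continuous_map (prod_topology (top_of_set {0..1}) (top_of_set UNIV)) (top_of_set UNIV) h"
      "\<And>q. h (0, q) = g0 q" "\<And>q. h (1, q) = g1 q"
    using hom unfolding homotopic_with_def by blast
  then have h: "continuous_on ({0..1} \<times> UNIV) h" "\<And>q. h (0, q) = g0 q" "\<And>q. h (1, q) = g1 q"
    by (simp_all only: prod_topology_subtopology_eu continuous_map_subtopology_eu)
  have "uniformly_continuous_on ({0..1} \<times> UNIV) h"
    using h(1) by (rule compact_uniformly_continuous) (intro compact_Times compact_Icc compact_torus3)
  then obtain d where d0: "d > 0" and d1: "\<forall>a\<in>{0..1} \<times> UNIV. \<forall>b\<in>{0..1} \<times> UNIV.
      dist b a < d \<longrightarrow> dist (h b) (h a) < 1/8"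
    unfolding uniformly_continuous_on_def by (elim allE[of _ "1/8"]) auto
  obtain N :: nat where N: "N > 0" "1 / real N < d"
    using nat_approx_posE[OF d0] by (metis zero_less_Suc)
  \<comment> \<open>Lift the homotopy at the times \<open>n / N\<close>, one after the other.\<close>
  have "\<exists>G. continuous_on UNIV G \<and> (\<forall>x. torus_proj (G x) = h (real n / real N, torus_proj x)) \<and>
          (\<forall>x. dist (G0 x) (G x) \<le> real n / 8)" if "n \<le> N" for n
    using that
  proof (induction n)
    case 0
    then show ?case using G0 h by (intro exI[of _ G0]) simp
  next
    case (Suc n)
    then obtain G where G: "continuous_on UNIV G" "\<And>x. torus_proj (G x) = h (real n / real N, torus_proj x)"
      "\<And>x. dist (G0 x) (G x) \<le> real n / 8" by auto
    have *: "real n / real N \<in> {0..1}" "real (Suc n) / real N \<in> {0..1}"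
      using Suc.prems N(1) by auto
    have c: "continuous_on UNIV (\<lambda>q. h (real (Suc n) / real N, q))"
      using *(2) by (intro continuous_on_compose2[OF h(1)] continuous_intros) auto
    have near: "dist (h (real n / real N, q)) (h (real (Suc n) / real N, q)) < 1/8" for q
    proof -
      have "dist (real (Suc n) / real N) (real n / real N) = 1 / real N"
        using N(1) by (simp add: dist_real_def flip: diff_divide_distrib)
      then have "dist (real (Suc n) / real N, q) (real n / real N, q) < d"
        using N(2) by (simp add: dist_Pair_Pair)
      then show ?thesis using d1 * by (metis UNIV_I dist_commute mem_Sigma_iff)
    qed
    obtain G' where G': "continuous_on UNIV G'"
      "\<And>x. torus_proj (G' x) = h (real (Suc n) / real N, torus_proj x)" "\<And>x. dist (G x) (G' x) < 1/8"
      using lift_nearby_map[OF c G(1,2) near] by blast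
    have "dist (G0 x) (G' x) \<le> real (Suc n) / 8" for x
      using dist_triangle[of "G0 x" "G' x" "G x"] G(3)[of x] G'(3)[of x] by (simp add: add_divide_distrib)
    then show ?case using G' by blast
  qed
  from this[of N] obtain G1 where "continuous_on UNIV G1" "\<And>x. torus_proj (G1 x) = h (1, torus_proj x)"
      "\<And>x. dist (G0 x) (G1 x) \<le> real N / 8" using N(1) by auto
  then show thesis using h(3) by (intro that[of G1 "real N / 8"]) auto
qed

lemma torus_deriv_eqI: "has_torus_derivative f D q \<Longrightarrow> torus_deriv f q = D"
  unfolding torus_deriv_def using has_torus_derivative_unique by (blast intro: the_equality)

text \<open>
  The torus derivative is defined by some local lift at some preimage of the point. Up to
  translations by lattice vectors, it agrees near the point with any continuous global lift, because
  their difference is continuous with values in the lattice.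
\<close>

lemma lift_has_derivative:
  assumes F: "continuous_on UNIV F" "\<And>x. torus_proj (F x) = f (torus_proj x)"
    and f: "C1_torus_map f"
  shows "(F has_derivative blinfun_apply (torus_deriv f (torus_proj x))) (at x)"
proof -
  obtain D where D: "has_torus_derivative f D (torus_proj x)"
    using f unfolding C1_torus_map_def by blast
  then obtain x' F' where x': "torus_proj x' = torus_proj x"
    and F': "\<forall>\<^sub>F y in nhds x'. torus_proj (F' y) = f (torus_proj y)"
    and dF': "(F' has_derivative blinfun_apply D) (at x')"
    unfolding has_torus_derivative_def by blast
  define k where "k = x' - x"
  have k: "k \<in> lattice3" using x' by (metis torus_proj_eq_iff k_def)
  define G where "G = (\<lambda>y. F' (y + k))"
  have dG: "(G has_derivative blinfun_apply D) (at x)"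
  proof -
    have 1: "((\<lambda>y. y + k) has_derivative (\<lambda>h. h)) (at x)"
      by (auto intro!: derivative_eq_intros)
    have "(F' has_derivative blinfun_apply D) (at ((\<lambda>y. y + k) x))"
      using dF' by (simp add: k_def)
    from has_derivative_compose[OF 1 this] show ?thesis by (simp add: G_def)
  qed
  have "filterlim (\<lambda>y. y + k) (nhds (x + k)) (nhds x)"
    by (intro tendsto_intros filterlim_ident)
  then have "\<forall>\<^sub>F y in nhds x. torus_proj (F' (y + k)) = f (torus_proj (y + k))"
    using F' unfolding k_def by (auto dest: eventually_compose_filterlim)
  then have G: "\<forall>\<^sub>F y in nhds x. torus_proj (G y) = f (torus_proj y)"
    by (simp add: G_def torus_proj_add_lattice[OF k])
  define m where "m = G x - F x"
  have m: "m \<in> lattice3"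
    using eventually_nhds_x_imp_x[OF G] F(2) unfolding m_def by (metis torus_proj_eq_iff)
  have "isCont (\<lambda>y. G y - F y) x"
    using F(1) dG has_derivative_continuous
    by (intro continuous_diff) (auto simp: continuous_on_eq_continuous_at)
  then have "filterlim (\<lambda>y. G y - F y) (nhds m) (nhds x)"
    unfolding m_def by (simp add: continuous_at tendsto_nhds_iff)
  then have near: "\<forall>\<^sub>F y in nhds x. dist (G y - F y) m < 1"
    by (rule tendstoD) simp
  have *: "\<forall>\<^sub>F y in nhds x. G y - m = F y"
    using G near
  proof eventually_elim
    case (elim y)
    have "G y - F y \<in> lattice3" using elim F(2) by (metis torus_proj_eq_iff)
    then have "(G y - F y) - m \<in> lattice3" using m by (rule lattice3_diff)
    moreover have "norm ((G y - F y) - m) < 1"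
      using elim(2) by (simp add: dist_norm)
    ultimately have "(G y - F y) - m = 0"
      by (rule lattice3_norm_less_1)
    then show ?case by (simp add: algebra_simps)
  qed
  have "((\<lambda>y. G y - m) has_derivative blinfun_apply D) (at x)"
    using dG by (auto intro!: derivative_eq_intros)
  then have "(F has_derivative blinfun_apply D) (at x)"
    by (rule has_derivative_transform_eventually)
      (use * eventually_nhds_x_imp_x[OF *] in \<open>auto simp: eventually_at_filter elim: eventually_mono\<close>)
  then show ?thesis using torus_deriv_eqI[OF D] by simp
qed

text \<open>
  The preimage of a projected line is a countable union of parallel lines, so a curve inside it
  stays on one of them: in the direction transverse to the lines it takes countably many values.
\<close>

lemma connected_in_parallel_lines:
  fixes \<gamma> :: "real \<Rightarrow> real^3"
  assumes S: "connected S" and cont: "continuous_on S \<gamma>"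
    and im: "\<And>s. s \<in> S \<Longrightarrow> torus_proj (\<gamma> s) \<in> torus_proj ` {y + w | w. w \<in> span {v}}"
    and st: "s \<in> S" "t \<in> S"
  shows "\<gamma> s - \<gamma> t \<in> span {v}"
proof -
  \<comment> \<open>The orthogonal projection along \<open>v\<close>; for \<open>v = 0\<close> it is the identity.\<close>
  define P where "P = (\<lambda>z::real^3. z - ((v \<bullet> z) / (v \<bullet> v)) *\<^sub>R v)"
  have P_span: "P w = 0" if "w \<in> span {v}" for w
    using that by (cases "v = 0") (auto simp: P_def span_singleton)
  have P_add: "P (a + b) = P a + P b" for a b
    by (simp add: P_def inner_add_right add_divide_distrib algebra_simps)
  have "P (\<gamma> s) \<in> (\<lambda>k. P (y + k)) ` lattice3" if s: "s \<in> S" for s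
  proof -
    obtain w where w: "w \<in> span {v}" "torus_proj (\<gamma> s) = torus_proj (y + w)" using im[OF s] by auto
    have k: "\<gamma> s - (y + w) \<in> lattice3" using w(2) by (simp add: torus_proj_eq_iff)
    have "P (\<gamma> s) = P (w + (y + (\<gamma> s - (y + w))))" by simp
    also have "\<dots> = P (y + (\<gamma> s - (y + w)))" unfolding P_add[of w] by (simp add: P_span w(1))
    finally show ?thesis using k by blast
  qed
  then have "(\<lambda>s. P (\<gamma> s)) ` S \<subseteq> (\<lambda>k. P (y + k)) ` lattice3" by blast
  then have "countable ((\<lambda>s. P (\<gamma> s)) ` S)"
    by (meson countable_image countable_lattice3 countable_subset)
  moreover have "connected ((\<lambda>s. P (\<gamma> s)) ` S)"
    unfolding P_def divide_inverse by (intro connected_continuous_image S continuous_intros cont)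
  ultimately have "P (\<gamma> s) = P (\<gamma> t)"
    using connected_uncountable[of "(\<lambda>s. P (\<gamma> s)) ` S"] st by blast
  then have "\<gamma> s - \<gamma> t = ((v \<bullet> \<gamma> s) / (v \<bullet> v) - (v \<bullet> \<gamma> t) / (v \<bullet> v)) *\<^sub>R v"
    by (simp add: P_def algebra_simps)
  then show ?thesis by (metis span_base span_scale singletonI)
qed



section \<open>Volume and the Jacobian\<close>

lemma unit_cube_borel: "unit_cube \<in> sets borel"
proof -
  have "unit_cube = (\<Inter>i. {x. 0 \<le> x $ i} \<inter> {x. x $ i < 1})"
    by (auto simp: unit_cube_def)
  moreover have "{x :: real^3. 0 \<le> x $ i} \<inter> {x. x $ i < 1} \<in> sets borel" for i
    using closed_halfspace_component_ge_cart[of 0 i] open_halfspace_component_lt_cart[of i 1]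
    by (intro sets.Int borel_closed borel_open) auto
  ultimately show ?thesis by (metis (no_types, lifting) UNIV_not_empty countable_finite finite_class.finite_UNIV sets.countable_INT image_subset_iff)
qed

text \<open>
  The volume of the torus is read off in the unit cube. A set on which the projection is injective
  is cut by the translates of the cube into countably many pieces; moving each of them back into
  the cube by a lattice vector changes neither its measure nor disjointness.
\<close>

lemma emeasure_torus_volume_proj_image:
  assumes B: "B \<in> sets borel" and pB: "torus_proj ` B \<in> sets borel" and inj: "inj_on torus_proj B"
  shows "emeasure torus_volume (torus_proj ` B) = emeasure lborel B"
proof -
  \<comment> \<open>\<open>Y k\<close> is the piece of \<open>B\<close> that the translation by \<open>k\<close> moves into the cube, and \<open>X k\<close> is
    the moved piece.\<close>
  define X where "X = (\<lambda>k. {x \<in> unit_cube. x - k \<in> B})"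
  define Y where "Y = (\<lambda>k. {x \<in> B. k + x \<in> unit_cube})"
  have X_sets: "X k \<in> sets lborel" for k
  proof -
    have "X k = unit_cube \<inter> ((\<lambda>x. x - k) -` B \<inter> space borel)" by (auto simp: X_def)
    moreover have "(\<lambda>x. x - k) \<in> measurable borel borel" by simp
    ultimately show ?thesis using unit_cube_borel B by (metis measurable_sets sets.Int sets_lborel)
  qed
  have Y_sets: "Y k \<in> sets lborel" for k
  proof -
    have "Y k = B \<inter> ((\<lambda>x. k + x) -` unit_cube \<inter> space borel)" by (auto simp: Y_def)
    moreover have "(\<lambda>x. k + x) \<in> measurable borel borel" by simp
    ultimately show ?thesis using unit_cube_borel B by (metis measurable_sets sets.Int sets_lborel)
  qed
  have XY: "emeasure lborel (X k) = emeasure lborel (Y k)" for k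
  proof -
    have "emeasure lborel (X k) = emeasure (distr lborel borel ((+) k)) (X k)"
      by (simp add: lborel_distr_plus)
    also have "\<dots> = emeasure lborel ((+) k -` X k \<inter> space lborel)"
      using X_sets[of k] by (intro emeasure_distr) auto
    also have "(+) k -` X k \<inter> space lborel = Y k" by (auto simp: X_def Y_def)
    finally show ?thesis .
  qed
  have X_disj: "disjoint_family_on X lattice3"
    unfolding disjoint_family_on_def
  proof (intro ballI impI)
    fix k l assume kl: "k \<in> lattice3" "l \<in> lattice3" "k \<noteq> l"
    have False if x: "x - k \<in> B" "x - l \<in> B" for x
    proof -
      have "(x - k) - (x - l) \<in> lattice3" using lattice3_diff[OF kl(2,1)] by simp
      then have "x - k = x - l" using inj x by (auto simp: inj_on_def torus_proj_eq_iff)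
      then show False using kl by simp
    qed
    then show "X k \<inter> X l = {}" by (auto simp: X_def)
  qed
  have Y_disj: "disjoint_family_on Y lattice3"
    unfolding disjoint_family_on_def
  proof (intro ballI impI)
    fix k l assume kl: "k \<in> lattice3" "l \<in> lattice3" "k \<noteq> l"
    have "\<not> (x + k \<in> unit_cube \<and> x + l \<in> unit_cube)" for x
      using unit_cube_translates[of x] kl by metis
    then show "Y k \<inter> Y l = {}" by (auto simp: Y_def add.commute)
  qed
  have UX: "(\<Union>k\<in>lattice3. X k) = {x \<in> unit_cube. torus_proj x \<in> torus_proj ` B}"
  proof (intro equalityI subsetI)
    fix x assume "x \<in> (\<Union>k\<in>lattice3. X k)"
    then obtain k where "k \<in> lattice3" "x \<in> unit_cube" "x - k \<in> B" by (auto simp: X_def)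
    moreover from this have "torus_proj x = torus_proj (x - k)" by (simp add: torus_proj_eq_iff)
    ultimately show "x \<in> {x \<in> unit_cube. torus_proj x \<in> torus_proj ` B}" by auto
  next
    fix x assume "x \<in> {x \<in> unit_cube. torus_proj x \<in> torus_proj ` B}"
    then obtain b where "x \<in> unit_cube" "b \<in> B" "x - b \<in> lattice3" by (auto simp: torus_proj_eq_iff)
    then show "x \<in> (\<Union>k\<in>lattice3. X k)" by (auto simp: X_def intro!: bexI[of _ "x - b"])
  qed
  have UY: "(\<Union>k\<in>lattice3. Y k) = B"
  proof -
    have "\<exists>k\<in>lattice3. k + x \<in> unit_cube" for x
      using unit_cube_translates[of x] by (metis add.commute)
    then show ?thesis by (auto simp: Y_def)
  qed
  have meas: "torus_proj \<in> measurable (restrict_space lborel unit_cube) borel"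
    by (intro measurable_restrict_space1 borel_measurable_continuous_onI continuous_intros
        measurable_cong_sets[THEN equalityD1, THEN subsetD, OF sets_lborel[symmetric] refl])
  have "emeasure torus_volume (torus_proj ` B)
      = emeasure (restrict_space lborel unit_cube) (torus_proj -` torus_proj ` B \<inter> space (restrict_space lborel unit_cube))"
    unfolding torus_volume_def unit_cube_def[symmetric] by (rule emeasure_distr[OF meas pB])
  also have "\<dots> = emeasure lborel (torus_proj -` torus_proj ` B \<inter> space (restrict_space lborel unit_cube))"
    using unit_cube_borel by (intro emeasure_restrict_space) (auto simp: space_restrict_space)
  also have "torus_proj -` torus_proj ` B \<inter> space (restrict_space lborel unit_cube) = (\<Union>k\<in>lattice3. X k)"
    unfolding UX by (auto simp: space_restrict_space)
  also have "emeasure lborel \<dots> = (\<integral>\<^sup>+k. emeasure lborel (X k) \<partial>count_space lattice3)"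
    by (intro emeasure_UN_countable X_sets countable_lattice3 X_disj)
  also have "\<dots> = (\<integral>\<^sup>+k. emeasure lborel (Y k) \<partial>count_space lattice3)" by (simp only: XY)
  also have "\<dots> = emeasure lborel (\<Union>k\<in>lattice3. Y k)"
    by (intro emeasure_UN_countable[symmetric] Y_sets countable_lattice3 Y_disj)
  finally show ?thesis by (simp only: UY)
qed

lemma space_torus_volume [simp]: "space torus_volume = UNIV"
  and sets_torus_volume [simp]: "sets torus_volume = sets borel"
  by (simp_all add: torus_volume_def)

lemma volume_preserving_lift_measure:
  assumes F: "continuous_on UNIV F" "\<And>x. torus_proj (F x) = f (torus_proj x)"
    and f: "inj f" "volume_preserving f" and r: "r \<le> 1/4"
  shows "inj_on F (cball x r)" "measure lebesgue (F ` cball x r) = measure lebesgue (cball x r)"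
proof -
  \<comment> \<open>Images of compact sets are compact, hence Borel: this is why closed balls are used.\<close>
  let ?B = "cball x r"
  have inj: "inj_on (\<lambda>y. torus_proj (F y)) ?B"
    using inj_on_torus_proj_ball[OF r, of x] f(1) by (auto simp: F(2) inj_on_def)
  then show "inj_on F ?B" by (auto simp: inj_on_def)
  have injF: "inj_on torus_proj (F ` ?B)" using inj by (auto simp: inj_on_def)
  have c1: "compact (F ` ?B)"
    using continuous_on_subset[OF F(1)] by (intro compact_continuous_image) auto
  have c2: "compact (torus_proj ` ?B)" "compact (torus_proj ` F ` ?B)"
    by (intro compact_continuous_image continuous_intros c1 compact_cball)+
  have vol: "emeasure torus_volume (torus_proj ` A) = emeasure lborel A"
    if "compact A" "compact (torus_proj ` A)" "inj_on torus_proj A" for A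
    using that by (intro emeasure_torus_volume_proj_image borel_compact)
  have im: "f -` torus_proj ` F ` ?B = torus_proj ` ?B"
  proof -
    have "torus_proj ` F ` ?B = f ` torus_proj ` ?B" by (simp add: image_image F(2))
    then show ?thesis by (simp only: inj_vimage_image_eq[OF f(1)])
  qed
  have "emeasure lborel (F ` ?B) = emeasure (distr torus_volume torus_volume f) (torus_proj ` F ` ?B)"
    using f(2) vol[OF c1 c2(2) injF] by (simp add: volume_preserving_def)
  also have "\<dots> = emeasure torus_volume (torus_proj ` ?B)"
    using f(2) borel_compact[OF c2(2)]
    by (subst emeasure_distr) (auto simp: volume_preserving_def im)
  also have "\<dots> = emeasure lborel ?B"
    by (rule vol[OF compact_cball c2(1) inj_on_torus_proj_ball[OF r]])
  finally show "measure lebesgue (F ` ?B) = measure lebesgue ?B"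
    using borel_compact[OF c1] by (simp add: measure_def)
qed

text \<open>
  The mean of the Jacobian over every small ball is \<open>1\<close>, so by continuity its value at the centre
  is \<open>1\<close>.
\<close>

lemma abs_det_eq_1_if_measure_preserving:
  fixes F :: "real^3 \<Rightarrow> real^3"
  assumes der: "\<And>y. (F has_derivative D y) (at y)"
    and cont: "continuous_on UNIV (\<lambda>y. det (matrix (D y)))"
    and r0: "r0 > 0" and inj: "\<And>r. r \<le> r0 \<Longrightarrow> inj_on F (cball x r)"
    and meas: "\<And>r. r \<le> r0 \<Longrightarrow> measure lebesgue (F ` cball x r) = measure lebesgue (cball x r)"
  shows "\<bar>det (matrix (D x))\<bar> = 1"
proof (rule ccontr)
  define g where "g = (\<lambda>y. \<bar>det (matrix (D y))\<bar>)"
  assume "\<bar>det (matrix (D x))\<bar> \<noteq> 1"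
  then have ne: "g x \<noteq> 1" by (simp add: g_def)
  have "isCont g x"
    using cont by (auto simp: g_def continuous_on_eq_continuous_at intro!: continuous_rabs)
  then obtain d where d: "d > 0" "\<And>y. dist y x < d \<Longrightarrow> dist (g y) (g x) < \<bar>g x - 1\<bar> / 2"
    using ne unfolding continuous_at_eps_delta by (metis half_gt_zero_iff zero_less_abs_iff eq_iff_diff_eq_0)
  define r where "r = min r0 (d/2)"
  let ?B = "cball x r" and ?m = "measure lebesgue (cball x r)"
  have r: "r > 0" "r \<le> r0" "r < d" using d(1) r0 by (auto simp: r_def)
  have near: "\<bar>g y - g x\<bar> < \<bar>g x - 1\<bar> / 2" if "y \<in> ?B" for y
    using d(2)[of y] that r by (simp add: dist_real_def dist_commute)
  have m0: "?m > 0" using content_cball_pos[OF r(1), of x] by simp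
  have "(F ` ?B) \<in> lmeasurable"
  proof -
    have "continuous_on UNIV F"
      using der has_derivative_continuous by (blast intro: continuous_at_imp_continuous_on)
    then have "compact (F ` ?B)" by (meson compact_cball compact_continuous_image continuous_on_subset subset_UNIV)
    then show ?thesis by (rule lmeasurable_compact)
  qed
  then have I: "(g has_integral ?m) ?B"
    using has_measure_differentiable_image[of ?B F D ?m] der inj[OF r(2)] meas[OF r(2)]
    by (auto simp: g_def intro: has_derivative_at_withinI)
  have "((\<lambda>_. 1) has_integral ?m) ?B"
    using lmeasure_integral[OF lmeasurable_cball, of x r] integrable_on_const[OF lmeasurable_cball, of 1 x r]
    by (simp only: has_integral_iff)
  then have K: "((\<lambda>_. k) has_integral k * ?m) ?B" for k :: real
    using has_integral_mult_right[of "\<lambda>_. 1" ?m ?B k] by simp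
  show False
  proof (cases "g x > 1")
    case True
    have "(g x + 1) / 2 * ?m \<le> ?m"
    proof (rule has_integral_le[OF K I])
      fix y assume "y \<in> ?B" then show "(g x + 1) / 2 \<le> g y"
        using near[of y] True by (simp add: abs_if field_simps split: if_splits)
    qed
    then show False using m0 True by simp
  next
    case False
    have "?m \<le> (g x + 1) / 2 * ?m"
    proof (rule has_integral_le[OF I K])
      fix y assume "y \<in> ?B" then show "g y \<le> (g x + 1) / 2"
        using near[of y] False by (simp add: abs_if field_simps split: if_splits)
    qed
    then show False using m0 False ne by simp
  qed
qed



section \<open>Linear algebra in dimension three\<close>

text \<open>
  Both matrices preserve the line through \<open>v\<close> and induce the same map on the quotient by it. The
  determinant of the induced map is \<open>det M0 / l0\<close>, and its product with \<open>l1\<close> is \<open>det M1\<close>.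
\<close>

lemma det_times_eigenvalue_eq_if_diff_in_line:
  fixes M0 M1 :: "real^3^3"
  assumes diff: "\<And>w. M1 *v w - M0 *v w \<in> span {v}" and v: "v \<noteq> 0"
    and ev: "M0 *v v = l0 *\<^sub>R v" "M1 *v v = l1 *\<^sub>R v" and l0: "l0 \<noteq> 0"
  shows "det M1 * l0 = det M0 * l1"
proof -
  \<comment> \<open>The difference of the matrices is the rank one matrix \<open>v a\<^sup>T\<close>.\<close>
  define a where "a = (1 / (v \<bullet> v)) *\<^sub>R (v v* (M1 - M0))"
  have a: "M1 *v w = M0 *v w + (a \<bullet> w) *\<^sub>R v" for w
  proof -
    obtain c where c: "M1 *v w - M0 *v w = c *\<^sub>R v"
      using diff[of w] by (auto simp: span_singleton)
    have "a \<bullet> w = (v \<bullet> ((M1 - M0) *v w)) / (v \<bullet> v)"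
      by (simp add: a_def dot_lmul_matrix)
    also have "\<dots> = c" using v by (simp add: matrix_vector_mult_diff_rdistrib c)
    finally show ?thesis using c by (simp add: algebra_simps)
  qed
  \<comment> \<open>\<open>N = l0 I + v a\<^sup>T\<close>, so that \<open>M0 N = l0 M1\<close>.\<close>
  define N :: "real^3^3" where "N = (\<chi> i j. (if i = j then l0 else 0) + v $ i * a $ j)"
  have N: "N *v w = l0 *\<^sub>R w + (a \<bullet> w) *\<^sub>R v" for w
    by (simp add: N_def vec_eq_iff forall_3 matrix_vector_mult_def sum_3 inner_vec_def algebra_simps)
  have scale: "det (l0 *\<^sub>R M1) = l0 ^ 3 * det M1"
    by (simp add: det_3 power3_eq_cube algebra_simps)
  have "M0 ** N = l0 *\<^sub>R M1"
    unfolding matrix_eq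
    by (simp add: N a ev(1) matrix_vector_right_distrib scaleR_matrix_vector_assoc[symmetric]
        matrix_vector_mult_scaleR scaleR_add_right mult.commute flip: matrix_vector_mul_assoc)
  then have "det M0 * det N = l0 ^ 3 * det M1"
    by (metis det_mul scale)
  moreover have "det N = l0\<^sup>2 * l1"
  proof -
    have "l1 *\<^sub>R v = (l0 + a \<bullet> v) *\<^sub>R v" using a[of v] ev by (simp add: algebra_simps)
    then have "l1 = l0 + a \<bullet> v" using v by simp
    then show ?thesis
      by (simp add: N_def det_3 inner_vec_def sum_3 power2_eq_square algebra_simps)
  qed
  ultimately have "l0 ^ 3 * det M1 = det M0 * (l0\<^sup>2 * l1)" by simp
  then have "l0\<^sup>2 * (det M1 * l0) = l0\<^sup>2 * (det M0 * l1)"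
    by (simp only: power2_eq_square power3_eq_cube mult_ac)
  then show ?thesis by (rule mult_left_cancel[THEN iffD1, rotated]) (use l0 in simp)
qed

text \<open>
  The eigenspace of \<open>\<mu>\<close> meets the plane spanned by the two other eigenvectors only in \<open>0\<close>, so its
  dimension is at most one.
\<close>

lemma eigenspace_is_line:
  fixes A :: "real^3^3"
  assumes ev: "A *v v = \<mu> *s v" "A *v p = \<alpha> *s p" "A *v q = \<beta> *s q"
    and nz: "v \<noteq> 0" "p \<noteq> 0" "q \<noteq> 0" and ne: "\<alpha> \<noteq> \<mu>" "\<beta> \<noteq> \<mu>" "\<alpha> \<noteq> \<beta>"
  shows "{w. A *v w = \<mu> *s w} = span {v}"
proof -
  let ?W = "{w. A *v w = \<mu> *s w}"
  note s = scalar_mult_eq_scaleR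
  have sub: "subspace ?W"
    by (auto simp: subspace_def s matrix_vector_right_distrib matrix_vector_mult_scaleR scaleR_add_right mult.commute)
  have pq: "p \<notin> span {q}"
  proof
    assume "p \<in> span {q}"
    then obtain c where c: "p = c *\<^sub>R q" by (auto simp: span_singleton)
    have "\<alpha> *\<^sub>R p = A *v p" using ev(2) by (simp add: s)
    also have "\<dots> = \<beta> *\<^sub>R p" using ev(3) by (simp add: c s matrix_vector_mult_scaleR)
    finally have "\<alpha> *\<^sub>R p = \<beta> *\<^sub>R p" .
    then show False using nz ne by auto
  qed
  have comb: "x = 0 \<and> y = 0" if "x *\<^sub>R p + y *\<^sub>R q = 0" for x y
  proof (cases "x = 0")
    case True then show ?thesis using that nz by simp
  next
    case False
    have "x *\<^sub>R p = (- y) *\<^sub>R q" using that by (simp add: eq_neg_iff_add_eq_0)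
    then have "p = (- y / x) *\<^sub>R q"
      using False by (metis divide_inverse_commute scaleR_left_imp_eq scaleR_scaleR right_inverse scaleR_one)
    then show ?thesis using pq by (metis span_base span_scale singletonI)
  qed
  have ind: "independent {p, q}"
    using pq nz by (simp add: independent_insert)
  have "p \<noteq> q" using pq by (metis span_base singletonI)
  then have d2: "dim (span {p, q}) = 2" using dim_span_eq_card_independent[OF ind] by simp
  have "?W \<inter> span {p, q} = {0}"
  proof (intro equalityI subsetI)
    fix w assume "w \<in> ?W \<inter> span {p, q}"
    then obtain x y where w: "A *v w = \<mu> *\<^sub>R w" "w = x *\<^sub>R p + y *\<^sub>R q"
      unfolding s by (auto simp: span_insert span_singleton) (metis diff_eq_eq add.commute)
    have "(x * (\<alpha> - \<mu>)) *\<^sub>R p + (y * (\<beta> - \<mu>)) *\<^sub>R q = A *v w - \<mu> *\<^sub>R w"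
      using ev(2,3) unfolding w(2) s
      by (simp add: matrix_vector_right_distrib matrix_vector_mult_scaleR algebra_simps)
    then have "x * (\<alpha> - \<mu>) = 0 \<and> y * (\<beta> - \<mu>) = 0" using w(1) by (intro comb) simp
    then show "w \<in> {0}" using ne w(2) by simp
  qed (use sub in \<open>auto simp: subspace_0 span_zero\<close>)
  then have "dim {x + y |x y. x \<in> ?W \<and> y \<in> span {p, q}} = dim ?W + 2"
    using dim_sums_Int[OF sub subspace_span, of "{p, q}"] d2 by simp
  moreover have "dim {x + y |x y. x \<in> ?W \<and> y \<in> span {p, q}} \<le> 3"
    using dim_subset_UNIV_cart[of "{x + y |x y. x \<in> ?W \<and> y \<in> span {p, q}}"] by simp
  ultimately have "dim ?W \<le> dim (span {v})" using nz(1) by simp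
  moreover have "span {v} \<subseteq> ?W" using ev(1) sub by (intro span_minimal) auto
  ultimately show ?thesis using subspace_dim_equal[OF subspace_span sub] by blast
qed

lemma direct_sum3_dims:
  fixes S T U :: "(real^3) set"
  assumes sub: "subspace S" "subspace T" "subspace U"
    and pos: "0 < dim S" "0 < dim T" "0 < dim U"
    and ex1: "\<And>v. \<exists>!(a, b, c). a \<in> S \<and> b \<in> T \<and> c \<in> U \<and> v = a + b + c"
  shows "dim S = 1" "dim T = 1" "dim U = 1"
proof -
  let ?ST = "{x + y |x y. x \<in> S \<and> y \<in> T}"
  have z: "0 \<in> S" "0 \<in> T" "0 \<in> U" using sub by (simp_all add: subspace_0)
  have uniq: "a = 0 \<and> b = 0 \<and> c = 0" if "a \<in> S" "b \<in> T" "c \<in> U" "a + b + c = 0" for a b c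
    using ex1[of 0] that z by (auto simp: Ex1_def) (metis add_0)+
  have "S \<inter> T = {0}"
  proof -
    have "x = 0" if "x \<in> S" "x \<in> T" for x
      using uniq[of x "- x" 0] that z sub by (simp add: subspace_neg)
    then show ?thesis using z by auto
  qed
  then have 1: "dim ?ST = dim S + dim T" using dim_sums_Int[OF sub(1,2)] by simp
  have "?ST \<inter> U = {0}"
  proof -
    have "a + b = 0" if "a \<in> S" "b \<in> T" "a + b \<in> U" for a b
      using uniq[OF that(1,2) subspace_neg[OF sub(3) that(3)]] by simp
    then show ?thesis using z by force
  qed
  then have "dim {x + y |x y. x \<in> ?ST \<and> y \<in> U} = dim S + dim T + dim U"
    using dim_sums_Int[OF subspace_sums[OF sub(1,2)] sub(3)] 1 by simp
  moreover have "dim {x + y |x y. x \<in> ?ST \<and> y \<in> U} \<le> 3"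
    using dim_subset_UNIV_cart[of "{x + y |x y. x \<in> ?ST \<and> y \<in> U}"] by simp
  ultimately show "dim S = 1" "dim T = 1" "dim U = 1" using pos by linarith+
qed

section \<open>Splittings into line bundles and adapted metrics\<close>

lemma nontrivial_subbundle_fibre:
  assumes "nontrivial_subbundle E"
  shows "subspace (E q)" "0 < dim (E q)"
  using assms unfolding nontrivial_subbundle_def subbundle_def by (metis subspace_span)+

lemma line_bundle_frame:
  assumes "nontrivial_subbundle E" "dim (E q) = 1"
  obtains U e where "open U" "q \<in> U" "continuous_on U e" "\<And>r. r \<in> U \<Longrightarrow> E r = span {e r}"
    "\<And>r. r \<in> U \<Longrightarrow> e r \<noteq> 0"
proof -
  obtain k where k: "subbundle k E" using assms(1) by (auto simp: nontrivial_subbundle_def)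
  have "\<exists>U e. open U \<and> q \<in> U \<and> (\<forall>i<k. continuous_on U (e i)) \<and>
        (\<forall>r\<in>U. E r = span ((\<lambda>i. e i r) ` {..<k}) \<and> dim (E r) = k)"
    using k unfolding subbundle_def by (rule spec)
  then obtain U :: "torus3 set" and e :: "nat \<Rightarrow> torus3 \<Rightarrow> real^3"
    where U: "open U" "q \<in> U" "\<forall>i<k. continuous_on U (e i)"
    "\<forall>r\<in>U. E r = span ((\<lambda>i. e i r) ` {..<k}) \<and> dim (E r) = k"
    by (elim exE conjE)
  then have k1: "k = 1" using assms(2) by metis
  have E: "E r = span {e 0 r}" if "r \<in> U" for r using U(4) that by (simp add: k1 lessThan_Suc)
  have nz: "e 0 r \<noteq> 0" if "r \<in> U" for r
  proof
    assume "e 0 r = 0"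
    then have "dim (E r) = 0" by (simp add: E[OF that])
    then show False using bspec[OF U(4) that, THEN conjunct2] k1 by linarith
  qed
  show thesis using U k1 by (intro that[of U "e 0"] E nz) auto
qed

text \<open>
  The definition of a metric asks for continuity only at fixed pairs of vectors. Expanding in a
  basis extends it to continuous vector fields.
\<close>

lemma continuous_on_riemannian_metric:
  assumes g: "riemannian_metric g" and ab: "continuous_on U a" "continuous_on U b"
  shows "continuous_on U (\<lambda>q. g q (a q) (b q))"
proof -
  have "g q v w = (\<Sum>i\<in>Basis. \<Sum>j\<in>Basis. (v \<bullet> i) * (w \<bullet> j) * g q i j)" for q v w
  proof -
    have bl: "bilinear (g q)" using g by (simp add: riemannian_metric_def)
    have "g q v w = g q (\<Sum>i\<in>Basis. (v \<bullet> i) *\<^sub>R i) (\<Sum>j\<in>Basis. (w \<bullet> j) *\<^sub>R j)"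
      by (simp add: euclidean_representation)
    also have "\<dots> = (\<Sum>i\<in>Basis. \<Sum>j\<in>Basis. g q ((v \<bullet> i) *\<^sub>R i) ((w \<bullet> j) *\<^sub>R j))"
      by (simp add: bilinear_sum[OF bl] sum.cartesian_product)
    also have "\<dots> = (\<Sum>i\<in>Basis. \<Sum>j\<in>Basis. (v \<bullet> i) * (w \<bullet> j) * g q i j)"
      by (simp add: bilinear_lmul[OF bl] bilinear_rmul[OF bl] mult_ac)
    finally show ?thesis .
  qed
  then have "(\<lambda>q. g q (a q) (b q))
      = (\<lambda>q. \<Sum>i\<in>Basis. \<Sum>j\<in>Basis. (a q \<bullet> i) * (b q \<bullet> j) * g q i j)" by blast
  moreover have "continuous_on U (\<lambda>q. g q v w)" for v w
    using g unfolding riemannian_metric_def by (meson continuous_on_subset subset_UNIV)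
  then have "continuous_on U (\<lambda>q. \<Sum>i\<in>Basis. \<Sum>j\<in>Basis. (a q \<bullet> i) * (b q \<bullet> j) * g q i j)"
    by (intro continuous_on_sum continuous_on_mult continuous_on_inner ab continuous_on_const)
  ultimately show ?thesis by metis
qed

text \<open>
  Cramer's rule.
\<close>

lemma triple_product_coordinate:
  fixes x y z :: "real^3"
  assumes "x \<bullet> cross3 y z \<noteq> 0" and v: "v = a *\<^sub>R x + b *\<^sub>R y + c *\<^sub>R z"
  shows "a = (v \<bullet> cross3 y z) / (x \<bullet> cross3 y z)"
proof -
  have "v \<bullet> cross3 y z = a * (x \<bullet> cross3 y z)"
    by (simp add: v inner_add_left dot_cross_self)
  then show ?thesis using assms(1) by simp
qed



lemma subbundle_sum_of_lines:
  assumes E: "nontrivial_subbundle E" "\<And>q. dim (E q) = 1"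
    and F: "nontrivial_subbundle F" "\<And>q. dim (F q) = 1"
    and int: "\<And>q. E q \<inter> F q = {0}"
  shows "subbundle 2 (\<lambda>q. {a + b |a b. a \<in> E q \<and> b \<in> F q})"
  unfolding subbundle_def
proof
  fix q
  obtain U d where U: "open U" "q \<in> U" "continuous_on U d" "\<And>r. r \<in> U \<Longrightarrow> E r = span {d r}"
    using line_bundle_frame[OF E(1) E(2)] by metis
  obtain V e where V: "open V" "q \<in> V" "continuous_on V e" "\<And>r. r \<in> V \<Longrightarrow> F r = span {e r}"
    using line_bundle_frame[OF F(1) F(2)] by metis
  define h where "h = (\<lambda>i::nat. if i = 0 then d else e)"
  have sum: "{a + b |a b. a \<in> E r \<and> b \<in> F r} = span ((\<lambda>i. h i r) ` {..<2})" if "r \<in> U \<inter> V" for r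
  proof -
    have "(\<lambda>i. h i r) ` {..<2} = {d r} \<union> {e r}"
      by (auto simp: h_def lessThan_Suc numeral_2_eq_2)
    then show ?thesis using U(4) V(4) that by (simp only: span_Un Int_iff)
  qed
  have dim: "dim {a + b |a b. a \<in> E r \<and> b \<in> F r} = 2" for r
    using dim_sums_Int[of "E r" "F r"] nontrivial_subbundle_fibre(1)[OF E(1)]
      nontrivial_subbundle_fibre(1)[OF F(1)] E(2) F(2) int by simp
  have cont: "continuous_on (U \<inter> V) (h i)" for i
    using U(3) V(3) by (auto simp: h_def intro: continuous_on_subset)
  show "\<exists>U e. open U \<and> q \<in> U \<and> (\<forall>i<2::nat. continuous_on U (e i)) \<and>
      (\<forall>r\<in>U. {a + b |a b. a \<in> E r \<and> b \<in> F r} = span ((\<lambda>i. e i r) ` {..<2}) \<and>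
        dim {a + b |a b. a \<in> E r \<and> b \<in> F r} = 2)"
    by (rule exI[of _ "U \<inter> V"], rule exI[of _ h], intro conjI ballI allI impI sum dim cont open_Int U(1) V(1) IntI U(2) V(2); simp)
qed

text \<open>
  Three nontrivial subbundles that split a tangent bundle of rank three are line bundles, hence the
  name. The locale is used with the stable, center and unstable bundles, in this order.
\<close>

locale line_splitting =
  fixes E1 E2 E3 :: "torus3 \<Rightarrow> (real^3) set"
  assumes nontriv: "nontrivial_subbundle E1" "nontrivial_subbundle E2" "nontrivial_subbundle E3"
    and ex1: "\<And>q v. \<exists>!(a, b, c). a \<in> E1 q \<and> b \<in> E2 q \<and> c \<in> E3 q \<and> v = a + b + c"
begin

lemma sub: "subspace (E1 q)" "subspace (E2 q)" "subspace (E3 q)"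
  using nontriv by (simp_all add: nontrivial_subbundle_fibre)

lemma dims: "dim (E1 q) = 1" "dim (E2 q) = 1" "dim (E3 q) = 1"
proof -
  have "0 < dim (E1 q)" "0 < dim (E2 q)" "0 < dim (E3 q)"
    using nontriv by (simp_all add: nontrivial_subbundle_fibre)
  from direct_sum3_dims[OF sub this ex1]
  show "dim (E1 q) = 1" "dim (E2 q) = 1" "dim (E3 q) = 1" .
qed

definition components :: "torus3 \<Rightarrow> real^3 \<Rightarrow> (real^3) \<times> (real^3) \<times> (real^3)" where
  "components q v = (THE (a, b, c). a \<in> E1 q \<and> b \<in> E2 q \<and> c \<in> E3 q \<and> v = a + b + c)"

definition p1 where "p1 q v = fst (components q v)"
definition p2 where "p2 q v = fst (snd (components q v))"
definition p3 where "p3 q v = snd (snd (components q v))"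

lemma components_eqI:
  assumes "a \<in> E1 q" "b \<in> E2 q" "c \<in> E3 q" "v = a + b + c"
  shows "p1 q v = a" "p2 q v = b" "p3 q v = c"
proof -
  have "components q v = (a, b, c)"
    unfolding components_def by (rule the1_equality[OF ex1]) (use assms in simp)
  then show "p1 q v = a" "p2 q v = b" "p3 q v = c" by (simp_all add: p1_def p2_def p3_def)
qed

lemma components: "p1 q v \<in> E1 q" "p2 q v \<in> E2 q" "p3 q v \<in> E3 q" "p1 q v + p2 q v + p3 q v = v"
proof -
  obtain a b c where *: "a \<in> E1 q" "b \<in> E2 q" "c \<in> E3 q" "v = a + b + c"
    using ex1[of q v] by auto
  from components_eqI[OF this] *
  show "p1 q v \<in> E1 q" "p2 q v \<in> E2 q" "p3 q v \<in> E3 q" "p1 q v + p2 q v + p3 q v = v" by simp_all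
qed

lemma components_in:
  "a \<in> E1 q \<Longrightarrow> b \<in> E2 q \<Longrightarrow> p1 q (a + b) = a \<and> p2 q (a + b) = b \<and> p3 q (a + b) = 0"
  "b \<in> E2 q \<Longrightarrow> c \<in> E3 q \<Longrightarrow> p1 q (b + c) = 0 \<and> p2 q (b + c) = b \<and> p3 q (b + c) = c"
  "a \<in> E1 q \<Longrightarrow> p1 q a = a \<and> p2 q a = 0 \<and> p3 q a = 0"
  "c \<in> E3 q \<Longrightarrow> p1 q c = 0 \<and> p2 q c = 0 \<and> p3 q c = c"
proof -
  have z: "0 \<in> E1 q" "0 \<in> E2 q" "0 \<in> E3 q" using sub by (simp_all add: subspace_0)
  show "a \<in> E1 q \<Longrightarrow> b \<in> E2 q \<Longrightarrow> p1 q (a + b) = a \<and> p2 q (a + b) = b \<and> p3 q (a + b) = 0"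
    using components_eqI[of a q b 0 "a + b"] z by simp
  show "b \<in> E2 q \<Longrightarrow> c \<in> E3 q \<Longrightarrow> p1 q (b + c) = 0 \<and> p2 q (b + c) = b \<and> p3 q (b + c) = c"
    using components_eqI[of 0 q b c "b + c"] z by simp
  show "a \<in> E1 q \<Longrightarrow> p1 q a = a \<and> p2 q a = 0 \<and> p3 q a = 0"
    using components_eqI[of a q 0 0 a] z by simp
  show "c \<in> E3 q \<Longrightarrow> p1 q c = 0 \<and> p2 q c = 0 \<and> p3 q c = c"
    using components_eqI[of 0 q 0 c c] z by simp
qed

lemma linear_components: "linear (p1 q)" "linear (p2 q)" "linear (p3 q)"
proof -
  have add: "p1 q (v + w) = p1 q v + p1 q w" "p2 q (v + w) = p2 q v + p2 q w"
    "p3 q (v + w) = p3 q v + p3 q w" for v w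
  proof -
    have "v + w = (p1 q v + p2 q v + p3 q v) + (p1 q w + p2 q w + p3 q w)"
      by (simp only: components(4))
    then have "v + w = (p1 q v + p1 q w) + (p2 q v + p2 q w) + (p3 q v + p3 q w)"
      by (simp only: add_ac)
    from components_eqI[OF _ _ _ this] components sub
    show "p1 q (v + w) = p1 q v + p1 q w" "p2 q (v + w) = p2 q v + p2 q w"
      "p3 q (v + w) = p3 q v + p3 q w" by (simp_all add: subspace_add)
  qed
  have scale: "p1 q (k *\<^sub>R v) = k *\<^sub>R p1 q v" "p2 q (k *\<^sub>R v) = k *\<^sub>R p2 q v"
    "p3 q (k *\<^sub>R v) = k *\<^sub>R p3 q v" for k v
  proof -
    have "k *\<^sub>R v = k *\<^sub>R p1 q v + k *\<^sub>R p2 q v + k *\<^sub>R p3 q v"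
      using components(4)[of q v] by (metis scaleR_add_right)
    from components_eqI[OF _ _ _ this] components sub
    show "p1 q (k *\<^sub>R v) = k *\<^sub>R p1 q v" "p2 q (k *\<^sub>R v) = k *\<^sub>R p2 q v"
      "p3 q (k *\<^sub>R v) = k *\<^sub>R p3 q v" by (simp_all add: subspace_scale)
  qed
  show "linear (p1 q)" "linear (p2 q)" "linear (p3 q)"
    by (intro linearI add scale)+
qed

lemma frame:
  obtains U e1 e2 e3 where "open U" "q \<in> U"
    "continuous_on U e1" "continuous_on U e2" "continuous_on U e3"
    "\<And>r. r \<in> U \<Longrightarrow> E1 r = span {e1 r}" "\<And>r. r \<in> U \<Longrightarrow> E2 r = span {e2 r}"
    "\<And>r. r \<in> U \<Longrightarrow> E3 r = span {e3 r}"
    "\<And>r. r \<in> U \<Longrightarrow> e1 r \<noteq> 0 \<and> e2 r \<noteq> 0 \<and> e3 r \<noteq> 0"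
proof -
  obtain U1 e1 where 1: "open U1" "q \<in> U1" "continuous_on U1 e1" "\<And>r. r \<in> U1 \<Longrightarrow> E1 r = span {e1 r}"
    "\<And>r. r \<in> U1 \<Longrightarrow> e1 r \<noteq> 0" using line_bundle_frame[OF nontriv(1) dims(1)] by metis
  obtain U2 e2 where 2: "open U2" "q \<in> U2" "continuous_on U2 e2" "\<And>r. r \<in> U2 \<Longrightarrow> E2 r = span {e2 r}"
    "\<And>r. r \<in> U2 \<Longrightarrow> e2 r \<noteq> 0" using line_bundle_frame[OF nontriv(2) dims(2)] by metis
  obtain U3 e3 where 3: "open U3" "q \<in> U3" "continuous_on U3 e3" "\<And>r. r \<in> U3 \<Longrightarrow> E3 r = span {e3 r}"
    "\<And>r. r \<in> U3 \<Longrightarrow> e3 r \<noteq> 0" using line_bundle_frame[OF nontriv(3) dims(3)] by metis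
  show thesis
    by (rule that[of "U1 \<inter> U2 \<inter> U3" e1 e2 e3])
      (use 1 2 3 in \<open>auto intro: continuous_on_subset\<close>)
qed

text \<open>
  Otherwise \<open>y \<times> z\<close> would be orthogonal to the whole frame, hence zero, and \<open>y\<close>, \<open>z\<close> would be
  parallel.
\<close>

lemma frame_triple_product:
  assumes E: "E1 q = span {x}" "E2 q = span {y}" "E3 q = span {z}" and nz: "x \<noteq> 0" "y \<noteq> 0" "z \<noteq> 0"
  shows "x \<bullet> cross3 y z \<noteq> 0"
proof
  assume 0: "x \<bullet> cross3 y z = 0"
  let ?n = "cross3 y z"
  obtain a b c where "p1 q ?n = a *\<^sub>R x" "p2 q ?n = b *\<^sub>R y" "p3 q ?n = c *\<^sub>R z"
    using components(1-3)[of q ?n] unfolding E span_singleton by auto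
  then have n: "?n = a *\<^sub>R x + b *\<^sub>R y + c *\<^sub>R z"
    using components(4)[of q ?n] by simp
  have "?n \<bullet> ?n = 0" by (subst (1) n) (simp add: inner_add_left dot_cross_self 0)
  then have "collinear {0, y, z}" by (simp add: cross_eq_0)
  then obtain k where k: "z = k *\<^sub>R y" using nz by (auto simp: collinear_lemma)
  have "z \<in> E2 q" "z \<in> E3 q" unfolding E by (auto simp: k span_base span_scale)
  then have "p2 q z = 0" "p2 q z = z"
    using components_in(4)[of z q] components_in(2)[of z q 0] sub by (auto simp: subspace_0)
  then show False using nz by simp
qed

text \<open>
  Near each point there are continuous frames of the three bundles, and the coordinates of a fixed
  vector in a frame are quotients of triple products of the frame vectors.
\<close>

lemma continuous_components:
  "continuous_on UNIV (\<lambda>q. p1 q v)" "continuous_on UNIV (\<lambda>q. p2 q v)" "continuous_on UNIV (\<lambda>q. p3 q v)"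
proof -
  have "\<exists>U. open U \<and> q \<in> U \<and> continuous_on U (\<lambda>q. p1 q v) \<and> continuous_on U (\<lambda>q. p2 q v)
      \<and> continuous_on U (\<lambda>q. p3 q v)" for q
  proof -
    obtain U e1 e2 e3 where U: "open U" "q \<in> U"
      "continuous_on U e1" "continuous_on U e2" "continuous_on U e3"
      and E: "\<And>r. r \<in> U \<Longrightarrow> E1 r = span {e1 r}" "\<And>r. r \<in> U \<Longrightarrow> E2 r = span {e2 r}"
      "\<And>r. r \<in> U \<Longrightarrow> E3 r = span {e3 r}"
      and nz: "\<And>r. r \<in> U \<Longrightarrow> e1 r \<noteq> 0 \<and> e2 r \<noteq> 0 \<and> e3 r \<noteq> 0"
      by (rule frame[of q]) blast
    define D where "D = (\<lambda>r. e1 r \<bullet> cross3 (e2 r) (e3 r))"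
    have D: "D r \<noteq> 0" if "r \<in> U" for r
      unfolding D_def using frame_triple_product[OF E[OF that]] nz[OF that] by blast
    have cyc: "e2 r \<bullet> cross3 (e3 r) (e1 r) = D r" "e3 r \<bullet> cross3 (e1 r) (e2 r) = D r" for r
      by (simp_all add: D_def cross3_simps)
    have contD: "continuous_on U D" unfolding D_def by (intro continuous_intros continuous_on_cross U)
    have eqs: "p1 r v = ((v \<bullet> cross3 (e2 r) (e3 r)) / D r) *\<^sub>R e1 r
       \<and> p2 r v = ((v \<bullet> cross3 (e3 r) (e1 r)) / D r) *\<^sub>R e2 r
       \<and> p3 r v = ((v \<bullet> cross3 (e1 r) (e2 r)) / D r) *\<^sub>R e3 r" if r: "r \<in> U" for r
    proof -
      obtain a b c where p: "p1 r v = a *\<^sub>R e1 r" "p2 r v = b *\<^sub>R e2 r" "p3 r v = c *\<^sub>R e3 r"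
        using components(1-3)[of r v] unfolding E[OF r] span_singleton by auto
      have v: "v = a *\<^sub>R e1 r + b *\<^sub>R e2 r + c *\<^sub>R e3 r" using components(4)[of r v] by (simp add: p)
      have "a = (v \<bullet> cross3 (e2 r) (e3 r)) / D r"
        using triple_product_coordinate[OF _ v] D[OF r] by (simp add: D_def)
      moreover have "v = b *\<^sub>R e2 r + c *\<^sub>R e3 r + a *\<^sub>R e1 r" using v by (simp add: algebra_simps)
      then have "b = (v \<bullet> cross3 (e3 r) (e1 r)) / D r"
        using triple_product_coordinate[of "e2 r" "e3 r" "e1 r"] D[OF r] by (simp add: cyc)
      moreover have "v = c *\<^sub>R e3 r + a *\<^sub>R e1 r + b *\<^sub>R e2 r" using v by (simp add: algebra_simps)
      then have "c = (v \<bullet> cross3 (e1 r) (e2 r)) / D r"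
        using triple_product_coordinate[of "e3 r" "e1 r" "e2 r"] D[OF r] by (simp add: cyc)
      ultimately show ?thesis by (simp add: p)
    qed
    have "continuous_on U (\<lambda>r. ((v \<bullet> cross3 (e2 r) (e3 r)) / D r) *\<^sub>R e1 r)"
      "continuous_on U (\<lambda>r. ((v \<bullet> cross3 (e3 r) (e1 r)) / D r) *\<^sub>R e2 r)"
      "continuous_on U (\<lambda>r. ((v \<bullet> cross3 (e1 r) (e2 r)) / D r) *\<^sub>R e3 r)"
      using D by (intro continuous_intros continuous_on_cross U contD; simp)+
    then have "continuous_on U (\<lambda>q. p1 q v)" "continuous_on U (\<lambda>q. p2 q v)" "continuous_on U (\<lambda>q. p3 q v)"
      using eqs by (simp_all cong: continuous_on_cong)
    then show ?thesis using U(1,2) by blast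
  qed
  then show "continuous_on UNIV (\<lambda>q. p1 q v)" "continuous_on UNIV (\<lambda>q. p2 q v)"
    "continuous_on UNIV (\<lambda>q. p3 q v)"
    by (auto simp: continuous_on_eq_continuous_at) (metis continuous_on_eq_continuous_at)+
qed

text \<open>
  The metric that makes the three bundles orthogonal, restricts to \<open>g\<close> on the outer two and to the
  Euclidean metric on the middle one. A map that preserves the bundles, is a strict contraction for
  \<open>g\<close> on the first one and a Euclidean contraction on the second one, contracts the sum of both in
  this metric. In \<open>g\<close> itself this may fail: the angles between the bundles vary, and a Euclidean
  contraction need not shrink \<open>g\<close>-lengths in one step.
\<close>

definition adapted :: "(torus3 \<Rightarrow> real^3 \<Rightarrow> real^3 \<Rightarrow> real) \<Rightarrow> torus3 \<Rightarrow> real^3 \<Rightarrow> real^3 \<Rightarrow> real" where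
  "adapted g q v w = g q (p1 q v) (p1 q w) + p2 q v \<bullet> p2 q w + g q (p3 q v) (p3 q w)"

lemma riemannian_metric_adapted:
  assumes g: "riemannian_metric g"
  shows "riemannian_metric (adapted g)"
  unfolding riemannian_metric_def
proof (intro conjI allI impI)
  fix q
  have bl: "bilinear (g q)" and sym: "\<And>v w. g q v w = g q w v" and pos: "\<And>v. v \<noteq> 0 \<Longrightarrow> g q v v > 0"
    using g by (auto simp: riemannian_metric_def)
  note L = linear_components[THEN linear_add] linear_components[THEN linear_scale]
  show "bilinear (adapted g q)"
    unfolding bilinear_def
    by (intro conjI allI linearI)
      (simp_all add: adapted_def L bilinear_ladd[OF bl] bilinear_radd[OF bl] bilinear_lmul[OF bl]
        bilinear_rmul[OF bl] inner_add_left inner_add_right algebra_simps)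
  show "adapted g q v w = adapted g q w v" for v w
    by (simp add: adapted_def sym inner_commute)
  have nonneg: "g q v v \<ge> 0" for v using pos[of v] by (cases "v = 0") (auto simp: bilinear_lzero[OF bl])
  fix v :: "real^3" assume "v \<noteq> 0"
  then have "p1 q v \<noteq> 0 \<or> p2 q v \<noteq> 0 \<or> p3 q v \<noteq> 0" using components(4)[of q v] by force
  then show "adapted g q v v > 0"
    unfolding adapted_def using nonneg[of "p1 q v"] nonneg[of "p3 q v"] inner_ge_zero[of "p2 q v"]
      pos[of "p1 q v"] pos[of "p3 q v"] inner_gt_zero_iff[of "p2 q v"] by linarith
next
  fix v w
  show "continuous_on UNIV (\<lambda>q. adapted g q v w)"
    unfolding adapted_def
    by (intro continuous_intros continuous_on_riemannian_metric[OF g] continuous_components)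
qed

lemma transversal_fibres: "E1 q \<inter> E2 q = {0}" "E2 q \<inter> E3 q = {0}"
proof -
  have z: "0 \<in> E1 q" "0 \<in> E2 q" "0 \<in> E3 q" using sub by (simp_all add: subspace_0)
  have "v = 0" if "v \<in> E1 q" "v \<in> E2 q" for v
    using components_in(3)[OF that(1)] components_in(2)[OF that(2) z(3)] by simp
  moreover have "v = 0" if "v \<in> E2 q" "v \<in> E3 q" for v
    using components_in(4)[OF that(2)] components_in(2)[OF that(1) z(3)] by simp
  ultimately show "E1 q \<inter> E2 q = {0}" "E2 q \<inter> E3 q = {0}" using z by auto
qed

end



section \<open>Constant center multiplier implies Anosov\<close>

lemma metric_norm_scaleR:
  assumes "riemannian_metric g"
  shows "metric_norm g q (k *\<^sub>R v) = \<bar>k\<bar> * metric_norm g q v"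
proof -
  have bl: "bilinear (g q)" using assms by (simp add: riemannian_metric_def)
  have "g q (k *\<^sub>R v) (k *\<^sub>R v) = k\<^sup>2 * g q v v"
    by (simp add: bilinear_lmul[OF bl] bilinear_rmul[OF bl] power2_eq_square)
  then show ?thesis by (simp add: metric_norm_def real_sqrt_mult)
qed

lemma metric_norm_pos:
  assumes "riemannian_metric g" "v \<noteq> 0"
  shows "0 < metric_norm g q v"
  using assms by (simp add: metric_norm_def riemannian_metric_def)

lemma metric_norm_normalize:
  assumes "riemannian_metric g" "v \<noteq> 0"
  shows "metric_norm g q ((1 / metric_norm g q v) *\<^sub>R v) = 1"
  using metric_norm_pos[OF assms, of q] by (simp add: metric_norm_scaleR[OF assms(1)])

lemma (in line_splitting) unit_vectors_exist:
  assumes g: "riemannian_metric g"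
  shows "\<exists>a\<in>E1 q. metric_norm g q a = 1" "\<exists>b\<in>E2 q. metric_norm g q b = 1" "\<exists>c\<in>E3 q. metric_norm g q c = 1"
proof -
  have "\<exists>a\<in>S. metric_norm g q a = 1" if "subspace S" "dim S = 1" for S
  proof -
    have "\<not> S \<subseteq> {0}" using that(2) by (metis dim_eq_0 zero_neq_one)
    then obtain v where "v \<in> S" "v \<noteq> 0" by blast
    then show ?thesis using metric_norm_normalize[OF g] subspace_scale[OF that(1)] by blast
  qed
  then show "\<exists>a\<in>E1 q. metric_norm g q a = 1" "\<exists>b\<in>E2 q. metric_norm g q b = 1" "\<exists>c\<in>E3 q. metric_norm g q c = 1"
    using sub dims by blast+
qed

text \<open>
  The center direction is added to the stable bundle if \<open>\<bar>\<mu>\<bar> < 1\<close> and to the unstable bundle if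
  \<open>\<bar>\<mu>\<bar> > 1\<close>. In the adapted metric the squared norm is the sum of the squared norms of the
  components, each of which shrinks, respectively grows.
\<close>

lemma anosov_if_center_homothety:
  assumes diff: "diffeomorphism f" and split: "partially_hyperbolic_splitting f Es Ec Eu"
    and center: "\<And>q v. v \<in> Ec q \<Longrightarrow> blinfun_apply (torus_deriv f q) v = \<mu> *\<^sub>R v" and \<mu>: "\<bar>\<mu>\<bar> \<noteq> 1"
  shows "anosov f"
proof -
  interpret line_splitting Es Ec Eu
    by standard (use split in \<open>simp_all add: partially_hyperbolic_splitting_def\<close>)
  let ?D = "\<lambda>q. blinfun_apply (torus_deriv f q)"
  have inv: "invariant_bundle f Es" "invariant_bundle f Ec" "invariant_bundle f Eu"
    using split by (simp_all add: partially_hyperbolic_splitting_def)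
  obtain g where g: "riemannian_metric g"
    and hyp: "\<And>x y z vs vc vu. vs \<in> Es x \<Longrightarrow> vc \<in> Ec y \<Longrightarrow> vu \<in> Eu z \<Longrightarrow>
       metric_norm g x vs = 1 \<Longrightarrow> metric_norm g y vc = 1 \<Longrightarrow> metric_norm g z vu = 1 \<Longrightarrow>
       metric_norm g (f x) (?D x vs) < 1 \<and> 1 < metric_norm g (f z) (?D z vu)"
    using split unfolding partially_hyperbolic_splitting_def by blast
  have stable: "g (f x) (?D x a) (?D x a) < g x a a" if a: "a \<in> Es x" "a \<noteq> 0" for x a
  proof -
    let ?n = "metric_norm g x a"
    have n: "?n > 0" by (rule metric_norm_pos[OF g a(2)])
    obtain b c where bc: "b \<in> Ec x" "metric_norm g x b = 1" "c \<in> Eu x" "metric_norm g x c = 1"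
      using unit_vectors_exist[OF g] by blast
    have "metric_norm g (f x) (?D x ((1 / ?n) *\<^sub>R a)) < 1"
      using hyp[OF subspace_scale[OF sub(1) a(1)] bc(1,3) metric_norm_normalize[OF g a(2)] bc(2,4)] by blast
    then have "metric_norm g (f x) (?D x a) < ?n"
      using n by (simp add: blinfun.scaleR_right metric_norm_scaleR[OF g] field_simps)
    then show ?thesis by (simp add: metric_norm_def)
  qed
  have unstable: "g x c c < g (f x) (?D x c) (?D x c)" if c: "c \<in> Eu x" "c \<noteq> 0" for x c
  proof -
    let ?n = "metric_norm g x c"
    have n: "?n > 0" by (rule metric_norm_pos[OF g c(2)])
    obtain a b where ab: "a \<in> Es x" "metric_norm g x a = 1" "b \<in> Ec x" "metric_norm g x b = 1"
      using unit_vectors_exist[OF g] by blast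
    have "1 < metric_norm g (f x) (?D x ((1 / ?n) *\<^sub>R c))"
      using hyp[OF ab(1,3) subspace_scale[OF sub(3) c(1)] ab(2,4) metric_norm_normalize[OF g c(2)]] by blast
    then have "?n < metric_norm g (f x) (?D x c)"
      using n by (simp add: blinfun.scaleR_right metric_norm_scaleR[OF g] field_simps)
    then show ?thesis by (simp add: metric_norm_def)
  qed
  have image: "?D q a \<in> Es (f q)" "?D q b \<in> Ec (f q)" "?D q c \<in> Eu (f q)"
    if "a \<in> Es q" "b \<in> Ec q" "c \<in> Eu q" for q a b c
    using inv that unfolding invariant_bundle_def by blast+
  have comp: "p1 (f q) (?D q v) = ?D q (p1 q v)" "p2 (f q) (?D q v) = \<mu> *\<^sub>R p2 q v"
    "p3 (f q) (?D q v) = ?D q (p3 q v)" for q v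
  proof -
    have "?D q v = ?D q (p1 q v) + ?D q (p2 q v) + ?D q (p3 q v)"
      by (simp only: components(4) flip: blinfun.add_right)
    from components_eqI[OF image[OF components(1-3)] this]
    show "p1 (f q) (?D q v) = ?D q (p1 q v)" "p2 (f q) (?D q v) = \<mu> *\<^sub>R p2 q v"
      "p3 (f q) (?D q v) = ?D q (p3 q v)" by (simp_all add: center[OF components(2)])
  qed
  define h where "h = adapted g"
  have h: "riemannian_metric h" unfolding h_def by (rule riemannian_metric_adapted[OF g])
  have g0: "g q 0 0 = 0" for q
    using g by (simp add: riemannian_metric_def bilinear_lzero)
  have hD: "h (f q) (?D q v) (?D q v)
      = g (f q) (?D q (p1 q v)) (?D q (p1 q v)) + \<mu>\<^sup>2 * (p2 q v \<bullet> p2 q v) + g (f q) (?D q (p3 q v)) (?D q (p3 q v))" for q v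
    by (simp add: h_def adapted_def comp power2_eq_square)
  have sum_inv: "?D q ` {a + b |a b. a \<in> S q \<and> b \<in> T q} = {a + b |a b. a \<in> S (f q) \<and> b \<in> T (f q)}"
    if "invariant_bundle f S" "invariant_bundle f T" for S T q
  proof -
    have *: "S (f q) = ?D q ` S q" "T (f q) = ?D q ` T q" using that by (simp_all add: invariant_bundle_def)
    have "{a + b |a b. a \<in> S (f q) \<and> b \<in> T (f q)} = {?D q a + ?D q b |a b. a \<in> S q \<and> b \<in> T q}"
      unfolding * by blast
    also have "\<dots> = ?D q ` {a + b |a b. a \<in> S q \<and> b \<in> T q}"
      by (auto simp: blinfun.add_right[symmetric])
    finally show ?thesis by simp
  qed
  have z: "0 \<in> Es q" "0 \<in> Ec q" "0 \<in> Eu q" for q using sub by (simp_all add: subspace_0)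
  consider "\<bar>\<mu>\<bar> < 1" | "\<bar>\<mu>\<bar> > 1" using \<mu> by linarith
  then show ?thesis
  proof cases
    case 1
    then have \<mu>2: "\<mu>\<^sup>2 < 1" by (simp add: abs_square_less_1)
    define S where "S = (\<lambda>q. {a + b |a b. a \<in> Es q \<and> b \<in> Ec q})"
    have "subbundle 2 S"
      unfolding S_def by (rule subbundle_sum_of_lines[OF nontriv(1) dims(1) nontriv(2) dims(2) transversal_fibres(1)])
    then have "nontrivial_subbundle S" unfolding nontrivial_subbundle_def by (metis zero_less_numeral)
    moreover have "\<exists>!(a, b). a \<in> S q \<and> b \<in> Eu q \<and> v = a + b" for q v
    proof (rule ex1I[of _ "(p1 q v + p2 q v, p3 q v)"])
      show "case (p1 q v + p2 q v, p3 q v) of (a, b) \<Rightarrow> a \<in> S q \<and> b \<in> Eu q \<and> v = a + b"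
        using components[of q v] by (auto simp: S_def)
      fix ab :: "(real^3) \<times> (real^3)" assume "case ab of (a, b) \<Rightarrow> a \<in> S q \<and> b \<in> Eu q \<and> v = a + b"
      then obtain a1 a2 b where *: "ab = (a1 + a2, b)" "a1 \<in> Es q" "a2 \<in> Ec q" "b \<in> Eu q" "v = a1 + a2 + b"
        by (auto simp: S_def)
      show "ab = (p1 q v + p2 q v, p3 q v)" using components_eqI[OF *(2-5)] *(1) by simp
    qed
    moreover have "invariant_bundle f S"
      using sum_inv[OF inv(1,2)] by (simp add: invariant_bundle_def S_def)
    moreover have "metric_norm h (f x) (?D x v) < 1" if v: "v \<in> S x" "metric_norm h x v = 1" for x v
    proof -
      obtain a b where ab: "a \<in> Es x" "b \<in> Ec x" "v = a + b" using v(1) by (auto simp: S_def)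
      have p: "p1 x v = a" "p2 x v = b" "p3 x v = 0" using components_in(1)[OF ab(1,2)] ab(3) by simp_all
      have hv: "h x v v = g x a a + b \<bullet> b" by (simp add: h_def adapted_def p g0)
      have "h x v v = 1" using v(2) by (simp add: metric_norm_def)
      then have "a \<noteq> 0 \<or> b \<noteq> 0" using hv g0 by auto
      moreover have "g (f x) (?D x a) (?D x a) \<le> g x a a" "a \<noteq> 0 \<Longrightarrow> g (f x) (?D x a) (?D x a) < g x a a"
        using stable[OF ab(1)] by (cases "a = 0"; simp add: g0 less_imp_le)+
      moreover have "\<mu>\<^sup>2 * (b \<bullet> b) \<le> b \<bullet> b" "b \<noteq> 0 \<Longrightarrow> \<mu>\<^sup>2 * (b \<bullet> b) < b \<bullet> b"
        using \<mu>2 by (simp_all add: mult_left_le_one_le)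
      ultimately have "g (f x) (?D x a) (?D x a) + \<mu>\<^sup>2 * (b \<bullet> b) < g x a a + b \<bullet> b"
        by (meson add_less_le_mono add_le_less_mono)
      then have "h (f x) (?D x v) (?D x v) < h x v v"
        by (simp add: hD p hv g0)
      then show ?thesis using \<open>h x v v = 1\<close> by (simp add: metric_norm_def)
    qed
    moreover have "1 < metric_norm h (f z) (?D z v)" if v: "v \<in> Eu z" "metric_norm h z v = 1" for z v
    proof -
      have p: "p1 z v = 0" "p2 z v = 0" "p3 z v = v" using components_in(4)[OF v(1)] by simp_all
      have hv: "h z v v = g z v v" by (simp add: h_def adapted_def p g0)
      have "h z v v = 1" using v(2) by (simp add: metric_norm_def)
      then have "v \<noteq> 0" using hv g0 by auto
      then have "h z v v < h (f z) (?D z v) (?D z v)"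
        unfolding hD p hv using unstable[OF v(1)] by (simp add: g0)
      then show ?thesis using \<open>h z v v = 1\<close> by (simp add: metric_norm_def)
    qed
    ultimately show ?thesis
      unfolding anosov_def using diff nontriv(3) inv(3) h by blast
  next
    case 2
    then have \<mu>2: "\<mu>\<^sup>2 > 1" using abs_square_le_1[of \<mu>] by linarith
    define S where "S = (\<lambda>q. {a + b |a b. a \<in> Ec q \<and> b \<in> Eu q})"
    have "subbundle 2 S"
      unfolding S_def by (rule subbundle_sum_of_lines[OF nontriv(2) dims(2) nontriv(3) dims(3) transversal_fibres(2)])
    then have "nontrivial_subbundle S" unfolding nontrivial_subbundle_def by (metis zero_less_numeral)
    moreover have "\<exists>!(a, b). a \<in> Es q \<and> b \<in> S q \<and> v = a + b" for q v
    proof (rule ex1I[of _ "(p1 q v, p2 q v + p3 q v)"])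
      show "case (p1 q v, p2 q v + p3 q v) of (a, b) \<Rightarrow> a \<in> Es q \<and> b \<in> S q \<and> v = a + b"
        using components[of q v] by (auto simp: S_def add.assoc)
      fix ab :: "(real^3) \<times> (real^3)" assume "case ab of (a, b) \<Rightarrow> a \<in> Es q \<and> b \<in> S q \<and> v = a + b"
      then obtain a b1 b2 where *: "ab = (a, b1 + b2)" "a \<in> Es q" "b1 \<in> Ec q" "b2 \<in> Eu q" "v = a + b1 + b2"
        by (auto simp: S_def add.assoc)
      show "ab = (p1 q v, p2 q v + p3 q v)" using components_eqI[OF *(2-5)] *(1) by simp
    qed
    moreover have "invariant_bundle f S"
      using sum_inv[OF inv(2,3)] by (simp add: invariant_bundle_def S_def)
    moreover have "1 < metric_norm h (f x) (?D x v)" if v: "v \<in> S x" "metric_norm h x v = 1" for x v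
    proof -
      obtain b c where bc: "b \<in> Ec x" "c \<in> Eu x" "v = b + c" using v(1) by (auto simp: S_def)
      have p: "p1 x v = 0" "p2 x v = b" "p3 x v = c" using components_in(2)[OF bc(1,2)] bc(3) by simp_all
      have hv: "h x v v = b \<bullet> b + g x c c" by (simp add: h_def adapted_def p g0)
      have "h x v v = 1" using v(2) by (simp add: metric_norm_def)
      then have "b \<noteq> 0 \<or> c \<noteq> 0" using hv g0 by auto
      moreover have "g x c c \<le> g (f x) (?D x c) (?D x c)" "c \<noteq> 0 \<Longrightarrow> g x c c < g (f x) (?D x c) (?D x c)"
        using unstable[OF bc(2)] by (cases "c = 0"; simp add: g0 less_imp_le)+
      moreover have "b \<bullet> b \<le> \<mu>\<^sup>2 * (b \<bullet> b)" "b \<noteq> 0 \<Longrightarrow> b \<bullet> b < \<mu>\<^sup>2 * (b \<bullet> b)"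
        using \<mu>2 mult_right_mono[of 1 "\<mu>\<^sup>2" "b \<bullet> b"] by simp_all
      ultimately have "b \<bullet> b + g x c c < \<mu>\<^sup>2 * (b \<bullet> b) + g (f x) (?D x c) (?D x c)"
        by (meson add_less_le_mono add_le_less_mono)
      then have "h x v v < h (f x) (?D x v) (?D x v)"
        by (simp add: hD p hv g0)
      then show ?thesis using \<open>h x v v = 1\<close> by (simp add: metric_norm_def)
    qed
    moreover have "metric_norm h (f x) (?D x v) < 1" if v: "v \<in> Es x" "metric_norm h x v = 1" for x v
    proof -
      have p: "p1 x v = v" "p2 x v = 0" "p3 x v = 0" using components_in(3)[OF v(1)] by simp_all
      have hv: "h x v v = g x v v" by (simp add: h_def adapted_def p g0)
      have "h x v v = 1" using v(2) by (simp add: metric_norm_def)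
      then have "v \<noteq> 0" using hv g0 by auto
      then have "h (f x) (?D x v) (?D x v) < h x v v"
        unfolding hD p hv using stable[OF v(1)] by (simp add: g0)
      then show ?thesis using \<open>h x v v = 1\<close> by (simp add: metric_norm_def)
    qed
    ultimately show ?thesis
      unfolding anosov_def using diff nontriv(1) inv(1) h by blast
  qed
qed



section \<open>Foliations by lines\<close>

lemma derivative_in_line:
  fixes G :: "'a::real_normed_vector \<Rightarrow> real^3"
  assumes D: "(G has_derivative D) (at x)" and near: "\<forall>\<^sub>F y in nhds x. G y - G x \<in> span {v}"
  shows "D h \<in> span {v}"
proof -
  have orth: "u \<bullet> D h = 0" if "u \<bullet> v = 0" for u
  proof -
    have perp: "u \<bullet> w = 0" if "w \<in> span {v}" for w
      using that \<open>u \<bullet> v = 0\<close> by (auto simp: span_singleton)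
    have ev: "\<forall>\<^sub>F y in nhds x. u \<bullet> G y = u \<bullet> G x"
      using near
    proof eventually_elim
      case (elim y)
      then show ?case using perp[OF elim] by (simp add: inner_diff_right)
    qed
    have "((\<lambda>y. u \<bullet> G x) has_derivative (\<lambda>h. 0)) (at x)" by simp
    then have "((\<lambda>y. u \<bullet> G y) has_derivative (\<lambda>h. 0)) (at x)"
      by (rule has_derivative_transform_eventually)
        (use ev in \<open>auto simp: eventually_at_filter elim: eventually_mono\<close>)
    moreover have "((\<lambda>y. u \<bullet> G y) has_derivative (\<lambda>h. u \<bullet> D h)) (at x)"
      using D by (rule has_derivative_inner_right)
    ultimately have "(\<lambda>h. 0) = (\<lambda>h. u \<bullet> D h)" by (rule has_derivative_unique)
    then show ?thesis by metis
  qed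
  show ?thesis
  proof (cases "v = 0")
    case True
    then show ?thesis using orth[of "D h"] by simp
  next
    case False
    define u where "u = D h - ((v \<bullet> D h) / (v \<bullet> v)) *\<^sub>R v"
    have uv: "u \<bullet> v = 0" using False by (simp add: u_def inner_diff_left inner_commute[of "D h" v])
    have "u \<bullet> u = u \<bullet> D h" by (subst (2) u_def) (simp add: inner_diff_right uv)
    then have "u = 0" using orth[OF uv] by simp
    then have "D h = ((v \<bullet> D h) / (v \<bullet> v)) *\<^sub>R v" by (simp add: u_def)
    then show ?thesis by (metis span_base span_scale singletonI)
  qed
qed

text \<open>
  A velocity is the derivative of some local lift. The lift is continuous near \<open>t\<close>, since it
  stays near its value at \<open>t\<close> and the projected curve is continuous; so it stays on one line.
\<close>

lemma velocity_in_line: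
  assumes I: "open I" "t \<in> I" and cont: "continuous_on I \<gamma>"
    and im: "\<And>s. s \<in> I \<Longrightarrow> \<gamma> s \<in> torus_proj ` {y + w | w. w \<in> span {v}}"
    and vel: "has_torus_velocity \<gamma> u t"
  shows "u \<in> span {v}"
proof -
  obtain \<Gamma> where \<Gamma>: "\<forall>\<^sub>F s in nhds t. torus_proj (\<Gamma> s) = \<gamma> s" "(\<Gamma> has_vector_derivative u) (at t)"
    using vel by (auto simp: has_torus_velocity_def)
  have "isCont \<Gamma> t" using \<Gamma>(2) by (rule has_vector_derivative_continuous)
  then have "filterlim \<Gamma> (nhds (\<Gamma> t)) (nhds t)" by (simp add: continuous_at tendsto_nhds_iff)
  then have "\<forall>\<^sub>F s in nhds t. dist (\<Gamma> s) (\<Gamma> t) < 1/4" by (rule tendstoD) simp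
  moreover have "\<forall>\<^sub>F s in nhds t. s \<in> I" using I by (rule eventually_nhds_in_open)
  ultimately have "\<forall>\<^sub>F s in nhds t. s \<in> I \<and> torus_proj (\<Gamma> s) = \<gamma> s \<and> dist (\<Gamma> s) (\<Gamma> t) < 1/4"
    using \<Gamma>(1) by eventually_elim blast
  then obtain d where d: "d > 0"
    "\<And>s. s \<in> ball t d \<Longrightarrow> s \<in> I \<and> torus_proj (\<Gamma> s) = \<gamma> s \<and> dist (\<Gamma> s) (\<Gamma> t) < 1/4"
    unfolding eventually_nhds_metric by (auto simp: dist_commute)
  have "isCont \<Gamma> s" if s: "s \<in> ball t d" for s
  proof (rule isCont_lift)
    have ev: "\<forall>\<^sub>F y in nhds s. y \<in> ball t d" using s by (intro eventually_nhds_in_open) auto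
    show "\<forall>\<^sub>F y in at s. dist (\<Gamma> y) (\<Gamma> s) < 1/2"
      unfolding eventually_at_filter
    proof (rule eventually_mono[OF ev], intro impI)
      fix y assume "y \<in> ball t d"
      then show "dist (\<Gamma> y) (\<Gamma> s) < 1/2"
        using d(2)[of y] d(2)[OF s] dist_triangle2[of "\<Gamma> y" "\<Gamma> s" "\<Gamma> t"] by linarith
    qed
    have "isCont \<gamma> s" using cont I(1) d(2)[OF s] by (simp add: continuous_on_eq_continuous_at)
    moreover have "\<forall>\<^sub>F y in nhds s. torus_proj (\<Gamma> y) = \<gamma> y"
      using ev by (rule eventually_mono) (use d(2) in blast)
    ultimately show "isCont (\<lambda>y. torus_proj (\<Gamma> y)) s" by (simp add: isCont_cong)
  qed
  then have c: "continuous_on (ball t d) \<Gamma>" by (simp add: continuous_at_imp_continuous_on)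
  have "\<Gamma> s - \<Gamma> t \<in> span {v}" if "s \<in> ball t d" for s
    by (rule connected_in_parallel_lines[OF _ c, of y]) (use d im that in auto)
  then have "\<forall>\<^sub>F s in nhds t. \<Gamma> s - \<Gamma> t \<in> span {v}"
    using d(1) by (auto simp: eventually_nhds_metric dist_commute)
  from derivative_in_line[OF \<Gamma>(2)[unfolded has_vector_derivative_def] this, of 1]
  show ?thesis by simp
qed

text \<open>
  The plaque through \<open>q\<close> lies in a leaf, which is a projected line, and its velocity at \<open>q\<close> is a
  nonzero vector in \<open>E q\<close>.
\<close>

lemma foliation_by_lines_tangent:
  assumes fol: "foliation_tangent_to (range (\<lambda>x. torus_proj ` {x + w |w. w \<in> span {v}})) E"
  shows "\<exists>u\<in>E q. u \<noteq> 0 \<and> u \<in> span {v}"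
proof -
  let ?F = "range (\<lambda>x. torus_proj ` {x + w |w. w \<in> span {v}})"
  let ?I = "{-1<..<1::real}"
  have "\<exists>U (\<psi> :: (real^2) \<times> real \<Rightarrow> torus3) \<phi> V.
        open U \<and> q \<in> U \<and> homeomorphism (ball 0 1 \<times> ?I) U \<psi> \<phi> \<and>
        (\<forall>L\<in>?F. \<forall>C\<in>components (L \<inter> U). \<exists>c\<in>ball 0 1. C = (\<lambda>t. \<psi> (c, t)) ` ?I) \<and>
        continuous_on (ball 0 1 \<times> ?I) V \<and>
        (\<forall>c\<in>ball 0 1. \<forall>t\<in>?I. V (c, t) \<noteq> 0 \<and> V (c, t) \<in> E (\<psi> (c, t)) \<and>
           has_torus_velocity (\<lambda>s. \<psi> (c, s)) (V (c, t)) t)"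
    using fol unfolding foliation_tangent_to_def by (elim conjE) (erule spec)
  then obtain U and \<psi> :: "(real^2) \<times> real \<Rightarrow> torus3" and \<phi> V where
    *: "open U \<and> q \<in> U \<and> homeomorphism (ball 0 1 \<times> ?I) U \<psi> \<phi> \<and>
        (\<forall>L\<in>?F. \<forall>C\<in>components (L \<inter> U). \<exists>c\<in>ball 0 1. C = (\<lambda>t. \<psi> (c, t)) ` ?I) \<and>
        continuous_on (ball 0 1 \<times> ?I) V \<and>
        (\<forall>c\<in>ball 0 1. \<forall>t\<in>?I. V (c, t) \<noteq> 0 \<and> V (c, t) \<in> E (\<psi> (c, t)) \<and>
           has_torus_velocity (\<lambda>s. \<psi> (c, s)) (V (c, t)) t)"
    by (elim exE)
  from * have q: "q \<in> U" and homeo: "homeomorphism (ball 0 1 \<times> ?I) U \<psi> \<phi>"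
    and plaque: "\<forall>L\<in>?F. \<forall>C\<in>components (L \<inter> U). \<exists>c\<in>ball 0 1. C = (\<lambda>t. \<psi> (c, t)) ` ?I"
    and vel: "\<And>c t. c \<in> ball 0 1 \<Longrightarrow> t \<in> ?I \<Longrightarrow> V (c, t) \<noteq> 0 \<and> V (c, t) \<in> E (\<psi> (c, t)) \<and>
           has_torus_velocity (\<lambda>s. \<psi> (c, s)) (V (c, t)) t"
    by simp_all
  obtain x where x: "torus_proj x = q" using torus_proj_surj by blast
  define L where "L = torus_proj ` {x + w |w. w \<in> span {v}}"
  have "x = x + 0" by simp
  then have qL: "q \<in> L" unfolding L_def x[symmetric] using span_0 by blast
  have comp: "connected_component_set (L \<inter> U) q \<in> components (L \<inter> U)"
    using q qL by (intro componentsI) simp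
  have "L \<in> ?F" by (auto simp: L_def)
  from bspec[OF bspec[OF plaque this] comp]
  obtain c where c: "c \<in> ball 0 1" "connected_component_set (L \<inter> U) q = (\<lambda>t. \<psi> (c, t)) ` ?I"
    by (rule bexE)
  have "q \<in> connected_component_set (L \<inter> U) q" using q qL by simp
  then obtain t where t: "t \<in> ?I" "q = \<psi> (c, t)" unfolding c(2) by blast
  have in_leaf: "\<psi> (c, s) \<in> L" if "s \<in> ?I" for s
    using that connected_component_subset[of "L \<inter> U" q] unfolding c(2) by blast
  have "continuous_on (ball 0 1 \<times> ?I) \<psi>" using homeo by (simp add: homeomorphism_def)
  then have cont: "continuous_on ?I (\<lambda>s. \<psi> (c, s))"
    by (rule continuous_on_compose2) (use c(1) in \<open>auto intro!: continuous_intros\<close>)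
  have "V (c, t) \<in> span {v}"
  proof (rule velocity_in_line[OF _ t(1) cont])
    show "\<psi> (c, s) \<in> torus_proj ` {x + w |w. w \<in> span {v}}" if "s \<in> ?I" for s
      using in_leaf[OF that] by (simp only: L_def)
  qed (use vel[OF c(1) t(1)] in simp_all)
  then show ?thesis using vel[OF c(1) t(1)] t(2) by blast
qed

section \<open>The center multiplier\<close>

text \<open>
  Since \<open>F(y + tv) - F(y)\<close> is always a multiple of \<open>v\<close>, the derivatives at \<open>x + tv\<close> and at \<open>x\<close>
  agree modulo \<open>v\<close>. The determinants being \<open>\<plusminus>1\<close>, the multipliers agree up to sign, and a
  continuous function on a line with at most two values is constant.
\<close>

lemma center_multiplier_const_on_line:
  fixes F :: "real^3 \<Rightarrow> real^3"
  assumes der: "\<And>x. (F has_derivative D x) (at x)"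
    and cont: "continuous_on UNIV (\<lambda>x. D x v)" and v: "v \<noteq> 0"
    and line: "\<And>x t. F (x + t *\<^sub>R v) - F x \<in> span {v}"
    and ev: "\<And>x. D x v = l x *\<^sub>R v" and nz: "\<And>x. l x \<noteq> 0"
    and vol: "\<And>x. \<bar>det (matrix (D x))\<bar> = 1"
  shows "l (x + t *\<^sub>R v) = l x"
proof -
  have mat: "matrix (D x) *v w = D x w" for x w
    using matrix_vector_mul(3)[OF has_derivative_bounded_linear[OF der]] by metis
  have abs: "\<bar>l (x + t *\<^sub>R v)\<bar> = \<bar>l x\<bar>" for t
  proof -
    have "D (x + t *\<^sub>R v) w - D x w \<in> span {v}" for w
    proof (rule derivative_in_line[where x = x and h = w
          and D = "\<lambda>w. D (x + t *\<^sub>R v) w - D x w" and G = "\<lambda>y. F (y + t *\<^sub>R v) - F y"])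
      have 1: "((\<lambda>y. y + t *\<^sub>R v) has_derivative (\<lambda>h. h)) (at x)"
        by (auto intro!: derivative_eq_intros)
      have "((\<lambda>y. F (y + t *\<^sub>R v)) has_derivative D (x + t *\<^sub>R v)) (at x)"
        using has_derivative_compose[OF 1 der] .
      then show "((\<lambda>y. F (y + t *\<^sub>R v) - F y) has_derivative (\<lambda>w. D (x + t *\<^sub>R v) w - D x w)) (at x)"
        using der by (rule has_derivative_diff)
      show "\<forall>\<^sub>F y in nhds x. (F (y + t *\<^sub>R v) - F y) - (F (x + t *\<^sub>R v) - F x) \<in> span {v}"
        by (intro always_eventually allI span_diff line)
    qed
    then have "det (matrix (D (x + t *\<^sub>R v))) * l x = det (matrix (D x)) * l (x + t *\<^sub>R v)"
      by (intro det_times_eigenvalue_eq_if_diff_in_line[OF _ v]) (simp_all add: mat ev nz)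
    then have "\<bar>det (matrix (D (x + t *\<^sub>R v)))\<bar> * \<bar>l x\<bar> = \<bar>det (matrix (D x))\<bar> * \<bar>l (x + t *\<^sub>R v)\<bar>"
      by (simp only: abs_mult[symmetric])
    then show ?thesis by (simp add: vol)
  qed
  have l: "l y = (D y v \<bullet> v) / (v \<bullet> v)" for y using v by (simp add: ev)
  let ?m = "\<lambda>t. l (x + t *\<^sub>R v)"
  have "continuous_on UNIV (\<lambda>t. D (x + t *\<^sub>R v) v)"
    by (rule continuous_on_compose2[OF cont]) (auto intro!: continuous_intros)
  then have "continuous_on UNIV ?m"
    unfolding l divide_inverse by (intro continuous_intros)
  then have "connected (range ?m)" by (intro connected_continuous_image) simp_all
  moreover have "range ?m \<subseteq> {l x, - l x}" using abs by (auto simp: abs_eq_iff)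
  then have "countable (range ?m)" by (rule countable_subset) simp
  moreover have "?m 0 \<in> range ?m" "?m t \<in> range ?m" by blast+
  ultimately have "?m t = ?m 0" using connected_uncountable by blast
  then show ?thesis by simp
qed

lemma zero_if_multiples_bounded:
  fixes c :: "'a::real_normed_vector"
  assumes "\<And>t::real. norm (t *\<^sub>R c) \<le> C"
  shows "c = 0"
proof (rule ccontr)
  assume "c \<noteq> 0"
  then have "norm (((\<bar>C\<bar> + 1) / norm c) *\<^sub>R c) = \<bar>C\<bar> + 1" by simp
  then show False using assms[of "(\<bar>C\<bar> + 1) / norm c"] by linarith
qed

text \<open>
  On the line through \<open>x\<close>, both \<open>F\<close> and \<open>B\<close> are affine, with slopes \<open>l x\<close> and \<open>\<mu>\<close>; different
  slopes would let them drift apart without bound.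
\<close>

lemma center_multiplier_eq_linear:
  fixes F :: "real^3 \<Rightarrow> real^3" and B :: "real^3^3"
  assumes der: "\<And>x. (F has_derivative D x) (at x)"
    and ev: "\<And>x. D x v = l x *\<^sub>R v" and const: "\<And>t. l (x + t *\<^sub>R v) = l x"
    and B: "B *v v = \<mu> *\<^sub>R v" and v: "v \<noteq> 0"
    and bound: "\<And>x. dist (B *v x) (F x) \<le> C"
  shows "l x = \<mu>"
proof -
  have "((\<lambda>t. F (x + t *\<^sub>R v) - (t * l x) *\<^sub>R v) has_derivative (\<lambda>_. 0)) (at t)" for t
  proof -
    have 1: "((\<lambda>t. x + t *\<^sub>R v) has_derivative (\<lambda>h. h *\<^sub>R v)) (at t)"
      by (auto intro!: derivative_eq_intros)
    have "((\<lambda>t. F (x + t *\<^sub>R v)) has_derivative (\<lambda>h. D (x + t *\<^sub>R v) (h *\<^sub>R v))) (at t)"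
      using has_derivative_compose[OF 1 der] .
    moreover have "D (x + t *\<^sub>R v) (h *\<^sub>R v) = (h * l x) *\<^sub>R v" for h
      using linear_scale[OF has_derivative_linear[OF der]] by (simp add: ev const)
    ultimately have "((\<lambda>t. F (x + t *\<^sub>R v)) has_derivative (\<lambda>h. (h * l x) *\<^sub>R v)) (at t)" by simp
    moreover have "((\<lambda>t. (t * l x) *\<^sub>R v) has_derivative (\<lambda>h. (h * l x) *\<^sub>R v)) (at t)"
      by (auto intro!: derivative_eq_intros)
    ultimately show ?thesis using has_derivative_diff by fastforce
  qed
  then obtain c where c: "\<And>t. F (x + t *\<^sub>R v) - (t * l x) *\<^sub>R v = c"
    using has_derivative_zero_constant[of UNIV "\<lambda>t. F (x + t *\<^sub>R v) - (t * l x) *\<^sub>R v"] by auto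
  have F: "F (x + t *\<^sub>R v) = F x + (t * l x) *\<^sub>R v" for t
    using c[of t] c[of 0] by (simp add: algebra_simps)
  have "norm (t *\<^sub>R ((\<mu> - l x) *\<^sub>R v)) \<le> C + C" for t
  proof -
    have "t *\<^sub>R ((\<mu> - l x) *\<^sub>R v) = (B *v (x + t *\<^sub>R v) - F (x + t *\<^sub>R v)) - (B *v x - F x)"
      by (simp add: F matrix_vector_right_distrib matrix_vector_mult_scaleR B algebra_simps)
    also have "norm \<dots> \<le> norm (B *v (x + t *\<^sub>R v) - F (x + t *\<^sub>R v)) + norm (B *v x - F x)"
      by (rule norm_triangle_ineq4)
    also have "\<dots> \<le> C + C" using bound by (intro add_mono) (simp_all flip: dist_norm)
    finally show ?thesis .
  qed
  then have "(\<mu> - l x) *\<^sub>R v = 0" by (rule zero_if_multiples_bounded)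
  then show ?thesis using v by simp
qed

lemma hyperbolic_matrix_real_eigenvalue:
  assumes "hyperbolic_matrix A" and ev: "map_matrix real_of_int A *v v = \<mu> *s v" "v \<noteq> 0"
  shows "\<bar>\<mu>\<bar> \<noteq> 1"
proof -
  define w :: "complex^3" where "w = (\<chi> i. of_real (v $ i))"
  have "map_matrix of_int A *v w = of_real \<mu> *s w"
  proof (subst vec_eq_iff, rule allI)
    fix i
    have "(map_matrix of_int A *v w) $ i = of_real ((map_matrix real_of_int A *v v) $ i)"
      by (simp add: matrix_vector_mult_def w_def map_matrix_def)
    also have "\<dots> = (of_real \<mu> *s w) $ i" by (simp add: ev(1) w_def)
    finally show "(map_matrix of_int A *v w) $ i = (of_real \<mu> *s w) $ i" .
  qed
  moreover have "w \<noteq> 0" using ev(2) by (auto simp: w_def vec_eq_iff)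
  ultimately have "eigenvalue (map_matrix of_int A) (complex_of_real \<mu>)"
    unfolding eigenvalue_def by blast
  then show ?thesis using assms(1) by (auto simp: hyperbolic_matrix_def)
qed

text \<open>
  The derivative of \<open>f\<close> multiplies every vector of the center bundle by \<open>\<mu>c\<close>, whose modulus is
  not \<open>1\<close> because \<open>A\<close> is hyperbolic.
\<close>

theorem anosov_if_volume_preserving_linear_center:
  assumes A: "linear_anosov A"
    and eigen: "{\<mu>. eigenvalue (map_matrix real_of_int A) \<mu>} = {\<mu>s, \<mu>c, \<mu>u}"
      "\<bar>\<mu>s\<bar> < \<bar>\<mu>c\<bar>" "\<bar>\<mu>c\<bar> < \<bar>\<mu>u\<bar>"
    and f: "diffeomorphism f" "volume_preserving f"
    and hom: "homotopic_with_canon (\<lambda>_. True) UNIV UNIV f (torus_linear A)"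
    and fol: "center_foliation f (linear_foliation A \<mu>c)"
  shows "anosov f"
proof -
  let ?B = "map_matrix real_of_int A"
  have "eigenvalue ?B \<mu>s" "eigenvalue ?B \<mu>c" "eigenvalue ?B \<mu>u" using eigen(1) by blast+
  then obtain p v q where ev: "?B *v p = \<mu>s *s p" "?B *v v = \<mu>c *s v" "?B *v q = \<mu>u *s q"
    and nz: "p \<noteq> 0" "v \<noteq> 0" "q \<noteq> 0" unfolding eigenvalue_def by blast
  have W: "{w. ?B *v w = \<mu>c *s w} = span {v}"
    using eigen(2,3) by (intro eigenspace_is_line[OF ev(2,1,3) nz(2,1,3)]) auto
  have leaves: "linear_foliation A \<mu>c = range (\<lambda>x. torus_proj ` {x + w |w. w \<in> span {v}})"
    unfolding linear_foliation_def W[symmetric] by simp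
  obtain Es Ec Eu where split: "partially_hyperbolic_splitting f Es Ec Eu"
    and tangent: "foliation_tangent_to (linear_foliation A \<mu>c) Ec"
    and leaf: "\<And>L. L \<in> linear_foliation A \<mu>c \<Longrightarrow> f ` L \<in> linear_foliation A \<mu>c"
    using fol unfolding center_foliation_def by blast
  interpret line_splitting Es Ec Eu
    by standard (use split in \<open>simp_all add: partially_hyperbolic_splitting_def\<close>)
  have Ec: "Ec x = span {v}" for x
  proof -
    obtain u where u: "u \<in> Ec x" "u \<noteq> 0" "u \<in> span {v}"
      using foliation_by_lines_tangent[OF tangent[unfolded leaves]] by blast
    have "span {u} = Ec x"
      using u sub(2)[of x] dims(2)[of x] by (intro subspace_dim_equal span_minimal) simp_all
    moreover have "span {u} = span {v}"
      using u nz by (intro subspace_dim_equal span_minimal) simp_all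
    ultimately show ?thesis by simp
  qed
  have proj_B: "torus_proj (?B *v x) = torus_linear A (torus_proj x)" for x
    by (simp add: torus_linear.abs_eq)
  have hom': "homotopic_with_canon (\<lambda>_. True) UNIV UNIV (torus_linear A) f"
    using hom by (rule homotopic_with_symD)
  have contB: "continuous_on UNIV ((*v) ?B)"
    by (intro linear_continuous_on matrix_vector_mul_bounded_linear)
  obtain F C where F: "continuous_on UNIV F" "\<And>x. torus_proj (F x) = f (torus_proj x)"
    "\<And>x. dist (?B *v x) (F x) \<le> C"
    by (rule homotopy_lift_bounded[OF hom' contB proj_B]) (rule that)
  define D where "D = (\<lambda>x. blinfun_apply (torus_deriv f (torus_proj x)))"
  have C1: "C1_torus_map f" and bij: "bij f" using f(1) by (auto simp: diffeomorphism_def)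
  have der: "(F has_derivative D x) (at x)" for x
    unfolding D_def by (rule lift_has_derivative[OF F(1,2) C1])
  have contD: "continuous_on UNIV (\<lambda>x. D x w)" for w
  proof -
    have "continuous_on UNIV (torus_deriv f)" using C1 by (simp add: C1_torus_map_def)
    from continuous_on_compose2[OF this continuous_on_torus_proj[OF continuous_on_id] subset_UNIV]
    have "continuous_on UNIV (\<lambda>x. torus_deriv f (torus_proj x))" .
    then show ?thesis unfolding D_def by (intro continuous_intros)
  qed
  \<comment> \<open>The image of a leaf is a leaf.\<close>
  have line: "F (x + t *\<^sub>R v) - F x \<in> span {v}" for x t
  proof -
    obtain y where y: "f ` torus_proj ` {x + w |w. w \<in> span {v}} = torus_proj ` {y + w |w. w \<in> span {v}}"
      using leaf unfolding leaves by blast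
    have "F (x + t *\<^sub>R v) - F (x + 0 *\<^sub>R v) \<in> span {v}"
    proof (rule connected_in_parallel_lines[of UNIV "\<lambda>t. F (x + t *\<^sub>R v)" y])
      show "continuous_on UNIV (\<lambda>t. F (x + t *\<^sub>R v))"
        by (rule continuous_on_compose2[OF F(1)]) (auto intro!: continuous_intros)
      fix s :: real
      have "x + s *\<^sub>R v \<in> {x + w |w. w \<in> span {v}}" by (auto intro: span_scale span_base)
      then show "torus_proj (F (x + s *\<^sub>R v)) \<in> torus_proj ` {y + w |w. w \<in> span {v}}"
        unfolding y[symmetric] F(2) by blast
    qed simp_all
    then show ?thesis by simp
  qed
  have vol: "\<bar>det (matrix (D x))\<bar> = 1" for x
  proof (rule abs_det_eq_1_if_measure_preserving[OF der])
    show "continuous_on UNIV (\<lambda>y. det (matrix (D y)))"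
      unfolding det_3 matrix_def by (simp, intro continuous_intros contD)
    show "0 < (1/4 :: real)" by simp
    fix r :: real assume r: "r \<le> 1/4"
    note lift = volume_preserving_lift_measure[OF F(1,2) bij_is_inj[OF bij] f(2) r]
    show "inj_on F (cball x r)" by (rule lift(1))
    show "measure lebesgue (F ` cball x r) = measure lebesgue (cball x r)" by (rule lift(2))
  qed
  have image: "D x ` span {v} = span {v}" for x
  proof -
    have "invariant_bundle f Ec" using split by (simp add: partially_hyperbolic_splitting_def)
    then show ?thesis unfolding invariant_bundle_def Ec D_def by (rule spec)
  qed
  have "\<exists>k. D x v = k *\<^sub>R v \<and> k \<noteq> 0" for x
  proof -
    have "D x v \<in> span {v}" using image[of x] by (auto intro: span_base)
    then obtain k where k: "D x v = k *\<^sub>R v" by (auto simp: span_singleton)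
    have "k \<noteq> 0"
    proof
      assume "k = 0"
      then have "D x w = 0" if "w \<in> span {v}" for w
        using that k linear_scale[OF has_derivative_linear[OF der]] by (auto simp: span_singleton)
      then have "span {v} \<subseteq> {0}" using image[of x] by auto
      then show False using nz(2) by (auto dest: subsetD[OF _ span_base])
    qed
    with k show ?thesis by blast
  qed
  then obtain l where l: "\<And>x. D x v = l x *\<^sub>R v" "\<And>x. l x \<noteq> 0" by metis
  have const: "l (x + t *\<^sub>R v) = l x" for x t
    by (rule center_multiplier_const_on_line[OF der contD nz(2) line l vol])
  have mult: "l x = \<mu>c" for x
    by (rule center_multiplier_eq_linear[OF der l(1) const _ nz(2) F(3)]) (simp add: ev(2) scalar_mult_eq_scaleR)
  show ?thesis
  proof (rule anosov_if_center_homothety[OF f(1) split])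
    show "\<bar>\<mu>c\<bar> \<noteq> 1"
      using hyperbolic_matrix_real_eigenvalue[OF _ ev(2) nz(2)] A by (simp add: linear_anosov_def)
    fix r w assume "w \<in> Ec r"
    then obtain k where k: "w = k *\<^sub>R v" by (auto simp: Ec span_singleton)
    obtain x where x: "torus_proj x = r" using torus_proj_surj by blast
    have "D x v = \<mu>c *\<^sub>R v" by (simp add: l(1) mult)
    then show "blinfun_apply (torus_deriv f r) w = \<mu>c *\<^sub>R w"
      by (simp add: k D_def x blinfun.scaleR_right)
  qed
qed

theorem corollary1p2:
  shows "\<not> (\<exists>(f :: torus3 \<Rightarrow> torus3) (A :: int^3^3) \<mu>s \<mu>c \<mu>u.
    linear_anosov A \<and>
    {\<mu>. eigenvalue (map_matrix real_of_int A) \<mu>} = {\<mu>s, \<mu>c, \<mu>u} \<and>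
    \<bar>\<mu>s\<bar> < \<bar>\<mu>c\<bar> \<and> \<bar>\<mu>c\<bar> < \<bar>\<mu>u\<bar> \<and>
    diffeomorphism f \<and>
    volume_preserving f \<and>
    partially_hyperbolic f \<and>
    homotopic_with_canon (\<lambda>_. True) UNIV UNIV f (torus_linear A) \<and>
    \<not> anosov f \<and>
    robustly_transitive f \<and>
    center_foliation f (linear_foliation A \<mu>c))"
  using anosov_if_volume_preserving_linear_center by blast

end
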